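(* Let $a\in L^1([0,T],\mathbb{R})$, $b\in L^2([0,T],\mathbb{R})$ and $C<\infty$ be such that $\|S(t)\|_{\mathcal{L}(H)}\le C$ for all $t\in[0,T]$, and $\|S(t)F\|_{\mathcal{L}(H)}\le a(t)$, $\|S(t)B\|_{\mathcal{L}_2(U_0,H)}\le b(t)$ for all $t\in(0,T]$. Then there is a unique solution $K\in\mathcal{C}([0,T],\mathcal{L}_1(H))$ to the integral equation $$K(t)=S(t)Q_\xi S(t)^*+\int_0^t \big(S(t-s)FK(s)S(t-s)^*+S(t-s)K(s)(S(t-s)F)^*\big)\,ds+\int_0^t S(t-s)B(S(t-s)B)^*\,ds,\quad t\in[0,T],$$ and $K(t)\in\Sigma(H)$ for all $t\in[0,T]$.
   Context: $T<\infty$. $H$, $\hat H$, $U$ are real separable Hilbert spaces with $H\hookrightarrow\hat H$ continuously and densely. $\mathcal{L}$, $\mathcal{L}_1$, $\mathcal{L}_2$ denote bounded, trace class and Hilbert--Schmidt operators; $\Sigma(H)\subset\mathcal{L}(H)$ is the set of symmetric (self-adjoint) bounded operators and $\Sigma^+(H)$ its subset of positive semidefinite operators. $Q\in\Sigma^+(U)$ (not necessarily trace class) and $U_0=Q^{1/2}(U)$ with inner product $\langle Q^{-1/2}\cdot,Q^{-1/2}\cdot\rangle_U$ ($Q^{-1/2}$ the pseudoinverse of $Q^{1/2}$). $S=(S(t))_{t\in[0,T]}$ is a family of operators with $S(t)\in\mathcal{L}(\hat H,H)$ for $t\in(0,T]$ and $S(0)\in\mathcal{L}(H)$ (not assumed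 to be a semigroup); on $H$, $S(t)$ is understood as its restriction to $H$. $F\in\mathcal{L}(H,\hat H)$, $B\in\mathcal{L}_2(U_0,\hat H)$, $Q_\xi\in\mathcal{L}_1(H)\cap\Sigma^+(H)$. For every $v\in H$ the map $t\mapsto S(t)v\in H$ is continuous on $[0,T]$, the map $t\mapsto S(t)Fv\in H$ is continuous on $(0,T]$, and $t\mapsto S(t)B\in\mathcal{L}_2(U_0,H)$ is continuous on $(0,T]$. Adjoints of $S(t)$ and $S(t)F$ are those of operators in $\mathcal{L}(H)$; that of $S(t)B$ is of an operator $U_0\to H$. Integrals are Bochner integrals in $\mathcal{L}_1(H)$. $\mathcal{C}([0,T],\mathcal{L}_1(H))$ is the Banach space of continuous $\mathcal{L}_1(H)$-valued maps with the supremum norm. *)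

theory Defs
  imports "HOL-Analysis.Analysis"
begin

section \<open>Trace class operators\<close>

text \<open>
  The trace class operators on a Hilbert space are the nuclear ones, i.e. those of the form
  \<open>A x = \<Sum>n. \<langle>a n, x\<rangle> b n\<close> with \<open>\<Sum>n. \<parallel>a n\<parallel> \<parallel>b n\<parallel> < \<infinity>\<close>. The trace norm is the infimum of these
  sums over all such representations of \<open>A\<close> (Da Prato and Zabczyk, Stochastic Equations in Infinite
  Dimensions, Appendix C); it agrees with the trace of \<open>\<bar>A\<bar>\<close>.
\<close>

definition nuclear_rep ::
    "(nat \<Rightarrow> 'a) \<Rightarrow> (nat \<Rightarrow> 'a) \<Rightarrow> ('a::real_inner \<Rightarrow>\<^sub>L 'a) \<Rightarrow> bool" where
  "nuclear_rep a b A \<longleftrightarrow> summable (\<lambda>n. norm (a n) * norm (b n)) \<and>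
     (\<forall>x. (\<lambda>n. (a n \<bullet> x) *\<^sub>R b n) sums blinfun_apply A x)"

definition trace_class :: "('a::real_inner \<Rightarrow>\<^sub>L 'a) \<Rightarrow> bool" where
  "trace_class A \<longleftrightarrow> (\<exists>a b. nuclear_rep a b A)"

definition trace_norm :: "('a::real_inner \<Rightarrow>\<^sub>L 'a) \<Rightarrow> real" where
  "trace_norm A = Inf {\<Sum>n. norm (a n) * norm (b n) | a b. nuclear_rep a b A}"

lemma nuclear_rep_sum_nonneg:
  assumes "nuclear_rep a b A"
  shows "0 \<le> (\<Sum>n. norm (a n) * norm (b n))"
  using assms by (auto simp: nuclear_rep_def intro!: suminf_nonneg)

lemma trace_norm_le:
  assumes "nuclear_rep a b A"
  shows "trace_norm A \<le> (\<Sum>n. norm (a n) * norm (b n))"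
  unfolding trace_norm_def
proof (rule cInf_lower)
  show "(\<Sum>n. norm (a n) * norm (b n)) \<in> {\<Sum>n. norm (a n) * norm (b n) | a b. nuclear_rep a b A}"
    by (rule CollectI, rule exI[of _ a], rule exI[of _ b], rule conjI[OF refl assms])
  show "bdd_below {\<Sum>n. norm (a n) * norm (b n) | a b. nuclear_rep a b A}"
    by (rule bdd_belowI[of _ 0]) (elim CollectE exE conjE, simp add: nuclear_rep_sum_nonneg)
qed

lemma trace_norm_approx:
  assumes "trace_class A" "e > 0"
  obtains a b where "nuclear_rep a b A" "(\<Sum>n. norm (a n) * norm (b n)) < trace_norm A + e"
proof -
  let ?S = "{\<Sum>n. norm (a n) * norm (b n) | a b. nuclear_rep a b A}"
  obtain a b where ab: "nuclear_rep a b A"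
    using assms(1) unfolding trace_class_def by (elim exE)
  have "(\<Sum>n. norm (a n) * norm (b n)) \<in> ?S"
    by (rule CollectI, rule exI[of _ a], rule exI[of _ b], rule conjI[OF refl ab])
  then have "?S \<noteq> {}" by (rule ex_in_conv[THEN iffD1, OF exI])
  moreover have "Inf ?S < trace_norm A + e"
    unfolding trace_norm_def using assms(2) by linarith
  ultimately obtain y where y: "y \<in> ?S" "y < trace_norm A + e"
    by (rule cInf_lessD[THEN bexE])
  from y(1) obtain a' b' where "y = (\<Sum>n. norm (a' n) * norm (b' n))" "nuclear_rep a' b' A"
    by (elim CollectE exE conjE)
  with y(2) show ?thesis by (intro that) simp_all
qed

lemma trace_norm_nonneg:
  assumes "trace_class A"
  shows "0 \<le> trace_norm A"
proof (rule field_le_epsilon)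
  fix e :: real assume "0 < e"
  then obtain a b where ab: "nuclear_rep a b A" "(\<Sum>n. norm (a n) * norm (b n)) < trace_norm A + e"
    by (rule trace_norm_approx[OF assms])
  then show "0 \<le> trace_norm A + e"
    using nuclear_rep_sum_nonneg[OF ab(1)] by linarith
qed

lemma nuclear_rep_norm_le:
  fixes A :: "'a::{real_inner,banach} \<Rightarrow>\<^sub>L 'a"
  assumes "nuclear_rep a b A"
  shows "norm A \<le> (\<Sum>n. norm (a n) * norm (b n))"
proof (rule norm_blinfun_bound)
  show "0 \<le> (\<Sum>n. norm (a n) * norm (b n))"
    by (rule nuclear_rep_sum_nonneg[OF assms])
next
  fix x
  have s: "summable (\<lambda>n. norm (a n) * norm (b n))"
    and eq: "blinfun_apply A x = (\<Sum>n. (a n \<bullet> x) *\<^sub>R b n)"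
    using assms by (auto simp: nuclear_rep_def sums_iff)
  have le: "norm ((a n \<bullet> x) *\<^sub>R b n) \<le> (norm (a n) * norm (b n)) * norm x" for n
    using mult_right_mono[OF Cauchy_Schwarz_ineq2[of "a n" x] norm_ge_zero[of "b n"]]
    by (simp add: mult_ac)
  have s': "summable (\<lambda>n. (norm (a n) * norm (b n)) * norm x)"
    using s by (rule summable_mult2)
  have "norm (blinfun_apply A x) \<le> (\<Sum>n. (norm (a n) * norm (b n)) * norm x)"
    unfolding eq by (rule norm_suminf_le[OF le s'])
  then show "norm (blinfun_apply A x) \<le> (\<Sum>n. norm (a n) * norm (b n)) * norm x"
    using suminf_mult2[OF s, of "norm x"] by simp
qed


lemma norm_le_trace_norm:
  fixes A :: "'a::{real_inner,banach} \<Rightarrow>\<^sub>L 'a"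
  assumes "trace_class A"
  shows "norm A \<le> trace_norm A"
proof (rule field_le_epsilon)
  fix e :: real assume "0 < e"
  then obtain a b where ab: "nuclear_rep a b A" "(\<Sum>n. norm (a n) * norm (b n)) < trace_norm A + e"
    by (rule trace_norm_approx[OF assms])
  then show "norm A \<le> trace_norm A + e"
    using nuclear_rep_norm_le[OF ab(1)] by linarith
qed

lemma nuclear_rep_sums:
  fixes A :: "'a::{real_inner,banach} \<Rightarrow>\<^sub>L 'a"
  assumes rep: "\<And>k. nuclear_rep (a k) (b k) (X k)"
    and s: "summable (\<lambda>k. \<Sum>n. norm (a k n) * norm (b k n))"
    and X: "\<And>x. (\<lambda>k. blinfun_apply (X k) x) sums blinfun_apply A x"
  shows "trace_class A" "trace_norm A \<le> (\<Sum>k. \<Sum>n. norm (a k n) * norm (b k n))"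
proof -
  define g where "g = (\<lambda>(k, n). norm (a k n) * norm (b k n))"
  define a' where "a' m = (case prod_decode m of (k, n) \<Rightarrow> a k n)" for m
  define b' where "b' m = (case prod_decode m of (k, n) \<Rightarrow> b k n)" for m
  have g_nonneg: "g p \<ge> 0" for p by (simp add: g_def split: prod.split)
  have gk: "summable (\<lambda>n. g (k, n))" for k
    using rep[of k] by (simp add: g_def nuclear_rep_def)
  have gk_has: "((\<lambda>n. g (k, n)) has_sum (\<Sum>n. g (k, n))) UNIV" for k
    by (rule sums_nonneg_imp_has_sum) (auto simp: g_nonneg gk summable_sums)
  have gk_inf: "(\<Sum>\<^sub>\<infinity>n. g (k, n)) = (\<Sum>n. g (k, n))" for k
    by (rule infsumI[OF gk_has])
  have gs: "summable (\<lambda>k. \<Sum>n. g (k, n))" using s by (simp add: g_def)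
  have gs_nonneg: "0 \<le> (\<Sum>n. g (k, n))" for k by (rule suminf_nonneg[OF gk g_nonneg])
  have gs_has: "((\<lambda>k. \<Sum>n. g (k, n)) has_sum (\<Sum>k. \<Sum>n. g (k, n))) UNIV"
    by (rule sums_nonneg_imp_has_sum) (auto simp: gs_nonneg gs summable_sums)
  have g_abs: "(\<lambda>p. norm (g p)) summable_on UNIV \<times> UNIV"
    by (rule Infinite_Sum.abs_summable_on_Sigma_iff[THEN iffD2])
      (use has_sum_imp_summable[OF gk_has] has_sum_imp_summable[OF gs_has] g_nonneg gs_nonneg
        in \<open>simp add: gk_inf\<close>)
  have g_sum: "g summable_on UNIV"
    using Infinite_Sum.abs_summable_summable[OF g_abs] by simp
  have "infsum g (UNIV \<times> UNIV) = (\<Sum>\<^sub>\<infinity>k. \<Sum>\<^sub>\<infinity>n. g (k, n))"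
    using infsum_Sigma'_banach[of "\<lambda>k n. g (k, n)" UNIV "\<lambda>_. UNIV"] g_sum by simp
  also have "\<dots> = (\<Sum>k. \<Sum>n. g (k, n))"
    unfolding gk_inf by (rule infsumI[OF gs_has])
  finally have "(g has_sum (\<Sum>k. \<Sum>n. g (k, n))) UNIV"
    using has_sum_infsum[OF g_sum] by simp
  then have "((\<lambda>m. g (prod_decode m)) has_sum (\<Sum>k. \<Sum>n. g (k, n))) UNIV"
    using has_sum_reindex_bij_betw[OF bij_prod_decode, of g] by simp
  then have sums: "(\<lambda>m. norm (a' m) * norm (b' m)) sums (\<Sum>k. \<Sum>n. g (k, n))"
    unfolding g_def a'_def b'_def
    by (drule_tac has_sum_imp_sums) (simp add: case_prod_beta)
  have "(\<lambda>m. (a' m \<bullet> x) *\<^sub>R b' m) sums blinfun_apply A x" for x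
  proof -
    define f where "f = (\<lambda>(k, n). (a k n \<bullet> x) *\<^sub>R b k n)"
    have f_le: "norm (f p) \<le> norm (g p * norm x)" for p
    proof (cases p)
      case (Pair k n)
      then show ?thesis
        using mult_right_mono[OF Cauchy_Schwarz_ineq2[of "a k n" x] norm_ge_zero[of "b k n"]]
        by (simp add: f_def g_def mult_ac)
    qed
    have "(\<lambda>p. norm (g p * norm x)) summable_on UNIV"
      using summable_on_cmult_left[OF g_sum, of "norm x"] g_nonneg by simp
    then have f_abs: "(\<lambda>p. norm (f p)) summable_on UNIV"
      by (rule Infinite_Sum.abs_summable_on_comparison_test) (rule f_le)
    have f_sum: "f summable_on UNIV" by (rule Infinite_Sum.abs_summable_summable[OF f_abs])
    have fk_abs: "(\<lambda>n. norm (f (k, n))) summable_on UNIV" for k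
      using f_abs Infinite_Sum.abs_summable_on_Sigma_iff[of f UNIV "\<lambda>_. UNIV"] by simp
    have fk: "(\<Sum>\<^sub>\<infinity>n. f (k, n)) = blinfun_apply (X k) x" for k
    proof (rule sums_unique2)
      show "(\<lambda>n. f (k, n)) sums (\<Sum>\<^sub>\<infinity>n. f (k, n))"
        by (rule has_sum_imp_sums, rule has_sum_infsum, rule Infinite_Sum.abs_summable_summable[OF fk_abs])
      show "(\<lambda>n. f (k, n)) sums blinfun_apply (X k) x"
        using rep[of k] by (simp add: nuclear_rep_def f_def)
    qed
    have "(\<lambda>k. \<Sum>\<^sub>\<infinity>n. f (k, n)) summable_on UNIV"
      using summable_on_Sigma_banach[of "\<lambda>k n. f (k, n)" UNIV "\<lambda>_. UNIV"] f_sum by simp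
    then have "(\<lambda>k. blinfun_apply (X k) x) sums (\<Sum>\<^sub>\<infinity>k. \<Sum>\<^sub>\<infinity>n. f (k, n))"
      unfolding fk by (intro has_sum_imp_sums has_sum_infsum)
    then have "blinfun_apply A x = (\<Sum>\<^sub>\<infinity>k. \<Sum>\<^sub>\<infinity>n. f (k, n))"
      by (rule sums_unique2[OF X])
    also have "\<dots> = infsum f UNIV"
      using infsum_Sigma'_banach[of "\<lambda>k n. f (k, n)" UNIV "\<lambda>_. UNIV"] f_sum by simp
    finally have "(f has_sum blinfun_apply A x) UNIV"
      using has_sum_infsum[OF f_sum] by simp
    then have "((\<lambda>m. f (prod_decode m)) has_sum blinfun_apply A x) UNIV"
      using has_sum_reindex_bij_betw[OF bij_prod_decode, of f] by simp
    then show ?thesis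
      unfolding f_def a'_def b'_def
      by (drule_tac has_sum_imp_sums) (simp add: case_prod_beta)
  qed
  with sums have "nuclear_rep a' b' A"
    by (auto simp: nuclear_rep_def sums_iff)
  then show "trace_class A" "trace_norm A \<le> (\<Sum>k. \<Sum>n. norm (a k n) * norm (b k n))"
    using trace_norm_le[of a' b' A] sums by (auto simp: trace_class_def g_def sums_iff)
qed

lemma trace_class_sums:
  fixes A :: "'a::{real_inner,banach} \<Rightarrow>\<^sub>L 'a"
  assumes tc: "\<And>k. trace_class (X k)" and s: "summable (\<lambda>k. trace_norm (X k))"
    and X: "\<And>x. (\<lambda>k. blinfun_apply (X k) x) sums blinfun_apply A x"
  shows "trace_class A \<and> trace_norm A \<le> (\<Sum>k. trace_norm (X k))"
proof -
  have *: "trace_class A \<and> trace_norm A \<le> (\<Sum>k. trace_norm (X k)) + e" if e: "0 < e" for e :: real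
  proof -
    define d where "d k = e * (1/2) ^ Suc k" for k
    have d_pos: "0 < d k" for k using e by (simp add: d_def)
    have d: "d sums e" using sums_mult[OF power_half_series, of e] unfolding d_def by simp
    have "\<forall>k. \<exists>ab. nuclear_rep (fst ab) (snd ab) (X k) \<and>
        (\<Sum>n. norm (fst ab n) * norm (snd ab n)) < trace_norm (X k) + d k"
    proof
      fix k
      obtain a b where "nuclear_rep a b (X k)"
          "(\<Sum>n. norm (a n) * norm (b n)) < trace_norm (X k) + d k"
        by (rule trace_norm_approx[OF tc d_pos])
      then show "\<exists>ab. nuclear_rep (fst ab) (snd ab) (X k) \<and>
          (\<Sum>n. norm (fst ab n) * norm (snd ab n)) < trace_norm (X k) + d k"
        by (intro exI[of _ "(a, b)"]) simp
    qed
    then obtain ab where ab: "\<And>k. nuclear_rep (fst (ab k)) (snd (ab k)) (X k)"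
      "\<And>k. (\<Sum>n. norm (fst (ab k) n) * norm (snd (ab k) n)) < trace_norm (X k) + d k"
      by metis
    let ?s = "\<lambda>k. \<Sum>n. norm (fst (ab k) n) * norm (snd (ab k) n)"
    have sd: "summable (\<lambda>k. trace_norm (X k) + d k)"
      using s d by (auto intro: summable_add sums_summable)
    have ss: "summable ?s"
      by (rule summable_comparison_test'[OF sd])
        (simp only: real_norm_def abs_of_nonneg[OF nuclear_rep_sum_nonneg[OF ab(1)]] less_imp_le[OF ab(2)])
    have "suminf ?s \<le> (\<Sum>k. trace_norm (X k) + d k)"
      by (rule suminf_le[OF less_imp_le[OF ab(2)] ss sd])
    also have "\<dots> = (\<Sum>k. trace_norm (X k)) + e"
      using suminf_add[OF s sums_summable[OF d]] d by (simp add: sums_iff)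
    finally show ?thesis
      using nuclear_rep_sums[of "\<lambda>k. fst (ab k)" "\<lambda>k. snd (ab k)" X A, OF ab(1) ss X] by simp
  qed
  show ?thesis
    using *[OF zero_less_one] field_le_epsilon[of "trace_norm A" "\<Sum>k. trace_norm (X k)"] * by blast
qed

lemma nuclear_rep_rank_one:
  "nuclear_rep (\<lambda>n. if n = 0 then a else 0) (\<lambda>n. if n = 0 then b else 0)
     (Blinfun (\<lambda>x. (a \<bullet> x) *\<^sub>R b))" (is ?rep)
  "(\<Sum>n. norm (if n = 0 then a else 0) * norm (if n = 0 then b else 0)) = norm a * norm b"
  for a b :: "'a::{real_inner,banach}"
proof -
  have bl: "bounded_linear (\<lambda>x. (a \<bullet> x) *\<^sub>R b)"
    by (intro bounded_linear_scaleR_const bounded_linear_inner_right)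
  have eq: "(\<lambda>n. norm (if n = 0 then a else 0) * norm (if n = 0 then b else 0))
      = (\<lambda>n. if n = 0 then norm a * norm b else 0)"
    by auto
  have eq': "(\<lambda>n. ((if n = 0 then a else 0) \<bullet> x) *\<^sub>R (if n = 0 then b else 0))
      = (\<lambda>n. if n = 0 then (a \<bullet> x) *\<^sub>R b else 0)" for x
    by auto
  have 1: "(\<lambda>n. if n = 0 then norm a * norm b else 0) sums (norm a * norm b)"
    and 2: "(\<lambda>n. if n = 0 then (a \<bullet> x) *\<^sub>R b else 0) sums ((a \<bullet> x) *\<^sub>R b)" for x
    using sums_single[of 0 "\<lambda>_. norm a * norm b"] sums_single[of 0 "\<lambda>_. (a \<bullet> x) *\<^sub>R b"]
    by (simp_all add: eq_commute)
  show ?rep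
    unfolding nuclear_rep_def eq eq' using 1 2 bl
    by (auto simp: bounded_linear_Blinfun_apply sums_iff)
  show "(\<Sum>n. norm (if n = 0 then a else 0) * norm (if n = 0 then b else 0)) = norm a * norm b"
    unfolding eq using 1 by (simp add: sums_iff)
qed

lemma rank_one:
  fixes a b :: "'a::{real_inner,banach}"
  shows "trace_class (Blinfun (\<lambda>x. (a \<bullet> x) *\<^sub>R b))"
    and "trace_norm (Blinfun (\<lambda>x. (a \<bullet> x) *\<^sub>R b)) \<le> norm a * norm b"
    and "blinfun_apply (Blinfun (\<lambda>x. (a \<bullet> x) *\<^sub>R b)) x = (a \<bullet> x) *\<^sub>R b"
proof -
  show "trace_class (Blinfun (\<lambda>x. (a \<bullet> x) *\<^sub>R b))"
    unfolding trace_class_def by (intro exI) (rule nuclear_rep_rank_one(1))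
  show "trace_norm (Blinfun (\<lambda>x. (a \<bullet> x) *\<^sub>R b)) \<le> norm a * norm b"
    using trace_norm_le[OF nuclear_rep_rank_one(1)[of a b]]
    unfolding nuclear_rep_rank_one(2) .
  have "bounded_linear (\<lambda>x. (a \<bullet> x) *\<^sub>R b)"
    by (intro bounded_linear_scaleR_const bounded_linear_inner_right)
  then show "blinfun_apply (Blinfun (\<lambda>x. (a \<bullet> x) *\<^sub>R b)) x = (a \<bullet> x) *\<^sub>R b"
    by (simp add: bounded_linear_Blinfun_apply)
qed

lemma trace_class_0: "trace_class (0 :: 'a::real_inner \<Rightarrow>\<^sub>L 'a)"
  and trace_norm_0: "trace_norm (0 :: 'a \<Rightarrow>\<^sub>L 'a) = 0"
proof -
  have r: "nuclear_rep (\<lambda>_. 0) (\<lambda>_. 0) (0 :: 'a \<Rightarrow>\<^sub>L 'a)"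
    by (simp add: nuclear_rep_def)
  then show t: "trace_class (0 :: 'a \<Rightarrow>\<^sub>L 'a)" by (auto simp: trace_class_def)
  show "trace_norm (0 :: 'a \<Rightarrow>\<^sub>L 'a) = 0"
    using trace_norm_le[OF r] trace_norm_nonneg[OF t] by simp
qed

lemma trace_class_scaleR_le:
  assumes "trace_class A"
  shows "trace_class (r *\<^sub>R A) \<and> trace_norm (r *\<^sub>R A) \<le> \<bar>r\<bar> * trace_norm A"
proof -
  have *: "nuclear_rep (\<lambda>n. r *\<^sub>R a n) b (r *\<^sub>R A)"
      "(\<Sum>n. norm (r *\<^sub>R a n) * norm (b n)) = \<bar>r\<bar> * (\<Sum>n. norm (a n) * norm (b n))"
    if "nuclear_rep a b A" for a b
  proof -
    have s: "summable (\<lambda>n. norm (a n) * norm (b n))" and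
      A: "(\<lambda>n. (a n \<bullet> x) *\<^sub>R b n) sums blinfun_apply A x" for x
      using that by (auto simp: nuclear_rep_def)
    show "nuclear_rep (\<lambda>n. r *\<^sub>R a n) b (r *\<^sub>R A)"
      using summable_mult[OF s, of "\<bar>r\<bar>"] sums_scaleR_right[OF A, of r]
      by (auto simp: nuclear_rep_def mult_ac blinfun.scaleR_left)
    show "(\<Sum>n. norm (r *\<^sub>R a n) * norm (b n)) = \<bar>r\<bar> * (\<Sum>n. norm (a n) * norm (b n))"
      using suminf_mult[OF s, of "\<bar>r\<bar>"] by (simp add: mult_ac)
  qed
  have "trace_norm (r *\<^sub>R A) \<le> \<bar>r\<bar> * trace_norm A + e" if e: "0 < e" for e :: real
  proof -
    have "0 < e / (\<bar>r\<bar> + 1)" using e by simp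
    then obtain a b where ab: "nuclear_rep a b A"
        "(\<Sum>n. norm (a n) * norm (b n)) < trace_norm A + e / (\<bar>r\<bar> + 1)"
      by (rule trace_norm_approx[OF assms])
    have "trace_norm (r *\<^sub>R A) \<le> \<bar>r\<bar> * (\<Sum>n. norm (a n) * norm (b n))"
      using trace_norm_le[OF *(1)[OF ab(1)]] *(2)[OF ab(1)] by simp
    also have "\<dots> \<le> \<bar>r\<bar> * (trace_norm A + e / (\<bar>r\<bar> + 1))"
      using ab(2) by (intro mult_left_mono) auto
    also have "\<dots> \<le> \<bar>r\<bar> * trace_norm A + e"
      using e by (simp add: field_simps)
    finally show ?thesis .
  qed
  moreover obtain a b where "nuclear_rep a b A"
    using assms unfolding trace_class_def by (elim exE)
  ultimately show ?thesis
    unfolding trace_class_def using *(1) by (blast intro: field_le_epsilon)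
qed

lemma trace_norm_scaleR:
  assumes "trace_class A"
  shows "trace_norm (r *\<^sub>R A) = \<bar>r\<bar> * trace_norm A"
proof (cases "r = 0")
  case False
  have "trace_norm A \<le> \<bar>inverse r\<bar> * trace_norm (r *\<^sub>R A)"
    using trace_class_scaleR_le[of "r *\<^sub>R A" "inverse r"] trace_class_scaleR_le[OF assms, of r] False
    by simp
  then have "\<bar>r\<bar> * trace_norm A \<le> trace_norm (r *\<^sub>R A)"
    using False by (simp add: abs_inverse field_simps)
  then show ?thesis using trace_class_scaleR_le[OF assms, of r] by simp
qed (simp add: trace_norm_0)

lemma trace_class_add:
  fixes A B :: "'a::{real_inner,banach} \<Rightarrow>\<^sub>L 'a"
  assumes "trace_class A" "trace_class B"
  shows "trace_class (A + B) \<and> trace_norm (A + B) \<le> trace_norm A + trace_norm B"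
proof -
  define X where "X k = (if k = 0 then A else if k = 1 then B else 0)" for k :: nat
  have "(\<lambda>k. f (X k)) sums (f A + f B)" if "f 0 = 0" for f :: "('a \<Rightarrow>\<^sub>L 'a) \<Rightarrow> 'c::real_normed_vector"
    using sums_finite[of "{0, 1}" "\<lambda>k. f (X k)"] that by (auto simp: X_def)
  from this[of trace_norm] this[of "\<lambda>Y. blinfun_apply Y x" for x] show ?thesis
    using trace_class_sums[of X "A + B"] assms
    by (auto simp: sums_iff blinfun.add_left trace_norm_0 trace_class_0 X_def)
qed

text \<open>The space \<open>\<L>\<^sub>1(H)\<close>. The map \<open>op_of\<close> is the inclusion into the bounded operators;
  \<open>tc_of\<close> is meaningful on trace class operators only.\<close>

typedef (overloaded) 'a trace_class_op = "{A :: 'a::{real_inner,banach} \<Rightarrow>\<^sub>L 'a. trace_class A}"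
  morphisms op_of tc_of
  by (rule exI[of _ 0]) (simp add: trace_class_0)

lemma trace_class_op_of [simp]: "trace_class (op_of A)"
  using op_of[of A] by simp

lemma op_of_tc_of: "trace_class A \<Longrightarrow> op_of (tc_of A) = A"
  by (simp add: tc_of_inverse)

instantiation trace_class_op :: ("{real_inner,banach}") real_normed_vector
begin

definition "norm A = trace_norm (op_of A)"
definition "0 = tc_of 0"
definition "A + B = tc_of (op_of A + op_of B)"
definition "- A = tc_of (- op_of A)"
definition "A - B = tc_of (op_of A - op_of B)"
definition "r *\<^sub>R A = tc_of (r *\<^sub>R op_of A)"
definition "dist A B = norm (A - B)" for A B :: "'a trace_class_op"
definition "sgn A = inverse (norm A) *\<^sub>R A" for A :: "'a trace_class_op"
definition
  "(uniformity :: ('a trace_class_op \<times> 'a trace_class_op) filter) =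
     (INF e\<in>{0<..}. principal {(x, y). dist x y < e})"
definition
  "open (U :: 'a trace_class_op set) \<longleftrightarrow> (\<forall>x\<in>U. eventually (\<lambda>(x', y). x' = x \<longrightarrow> y \<in> U) uniformity)"

lemma op_of_simps:
  "op_of (0 :: 'a trace_class_op) = 0"
  "op_of (A + B) = op_of A + op_of B"
  "op_of (- A) = - op_of A"
  "op_of (A - B) = op_of A - op_of B"
  "op_of (r *\<^sub>R A) = r *\<^sub>R op_of A"
proof -
  have m: "trace_class (- op_of X)" for X :: "'a trace_class_op"
    using trace_class_scaleR_le[of "op_of X" "-1"] by simp
  then show "op_of (- A) = - op_of A"
    by (simp add: uminus_trace_class_op_def op_of_tc_of)
  show "op_of (A - B) = op_of A - op_of B"
    using trace_class_add[OF trace_class_op_of m, of A B]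
    by (simp add: minus_trace_class_op_def op_of_tc_of)
  show "op_of (0 :: 'a trace_class_op) = 0" "op_of (A + B) = op_of A + op_of B"
    "op_of (r *\<^sub>R A) = r *\<^sub>R op_of A"
    by (simp_all add: zero_trace_class_op_def plus_trace_class_op_def scaleR_trace_class_op_def
        op_of_tc_of trace_class_0 trace_class_add trace_class_scaleR_le)
qed

instance
proof
  fix A B C :: "'a trace_class_op" and r s :: real
  show "dist A B = norm (A - B)" by (rule dist_trace_class_op_def)
  show "sgn A = inverse (norm A) *\<^sub>R A" by (rule sgn_trace_class_op_def)
  show "(uniformity :: ('a trace_class_op \<times> 'a trace_class_op) filter) =
     (INF e\<in>{0<..}. principal {(x, y). dist x y < e})" by (rule uniformity_trace_class_op_def)
  show "open U \<longleftrightarrow> (\<forall>x\<in>U. eventually (\<lambda>(x', y). x' = x \<longrightarrow> y \<in> U) uniformity)"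
    for U :: "'a trace_class_op set" by (rule open_trace_class_op_def)
  show "norm A = 0 \<longleftrightarrow> A = 0"
  proof
    assume "norm A = 0"
    then have "op_of A = 0"
      using norm_le_trace_norm[of "op_of A"] by (simp add: norm_trace_class_op_def)
    then show "A = 0" by (simp flip: op_of_inject add: op_of_simps)
  qed (simp add: norm_trace_class_op_def op_of_simps trace_norm_0)
  show "norm (A + B) \<le> norm A + norm B"
    by (simp add: norm_trace_class_op_def op_of_simps trace_class_add)
  show "norm (r *\<^sub>R A) = \<bar>r\<bar> * norm A"
    by (simp add: norm_trace_class_op_def op_of_simps trace_norm_scaleR)
qed (simp_all flip: op_of_inject add: op_of_simps algebra_simps)

end

lemma op_of_sum: "op_of (sum f I) = (\<Sum>i\<in>I. op_of (f i))"
  by (induction I rule: infinite_finite_induct) (simp_all add: op_of_simps)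

instance trace_class_op :: ("{real_inner,banach}") banach
proof
  fix X :: "nat \<Rightarrow> 'a trace_class_op"
  assume C: "Cauchy X"
  then have "\<forall>k. \<exists>N. \<forall>m\<ge>N. \<forall>n\<ge>N. norm (X m - X n) < (1/2) ^ k"
    unfolding Cauchy_iff by simp
  from choice[OF this] obtain N where
    N: "\<And>k m n. m \<ge> N k \<Longrightarrow> n \<ge> N k \<Longrightarrow> norm (X m - X n) < (1/2) ^ k"
    by blast
  define r where "r k = (\<Sum>i\<le>k. N i) + k" for k
  have r: "strict_mono r" by (rule strict_monoI_Suc) (simp add: r_def)
  have rN: "N k \<le> r k" for k
    using member_le_sum[of k "{..k}" N] by (simp add: r_def trans_le_add1)
  define Y where "Y k = X (r (Suc k)) - X (r k)" for k
  have Y: "norm (Y k) \<le> (1/2) ^ k" for k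
    using N[of k "r (Suc k)" "r k"] rN[of k] strict_mono_less_eq[OF r, of k "Suc k"]
    by (simp add: Y_def)
  have "norm (op_of A) \<le> norm A" for A :: "'a trace_class_op"
    using norm_le_trace_norm[of "op_of A"] by (simp add: norm_trace_class_op_def)
  then have lip: "norm (op_of A - op_of B) \<le> norm (A - B)" for A B :: "'a trace_class_op"
    by (simp flip: op_of_simps(4))
  have "Cauchy (\<lambda>n. op_of (X n))"
    unfolding Cauchy_iff
  proof (intro allI impI)
    fix e :: real assume "0 < e"
    then obtain M where "\<forall>m\<ge>M. \<forall>n\<ge>M. norm (X m - X n) < e"
      using C unfolding Cauchy_iff by blast
    then show "\<exists>M. \<forall>m\<ge>M. \<forall>n\<ge>M. norm (op_of (X m) - op_of (X n)) < e"
      by (intro exI[of _ M]) (auto intro: le_less_trans[OF lip])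
  qed
  then have "convergent (\<lambda>n. op_of (X n))" by (rule Cauchy_convergent)
  then obtain L where L: "(\<lambda>n. op_of (X n)) \<longlonglongrightarrow> L"
    unfolding convergent_def by (elim exE)
  have Lr: "(\<lambda>n. op_of (X (r n))) \<longlonglongrightarrow> L"
    using LIMSEQ_subseq_LIMSEQ[OF L r] by (simp add: o_def)
  have tail: "trace_class (L - op_of (X (r n))) \<and>
      trace_norm (L - op_of (X (r n))) \<le> 2 * (1/2) ^ n" for n
  proof -
    have nY: "trace_norm (op_of (Y (k + n))) \<le> (1/2) ^ n * (1/2) ^ k" for k
      using Y[of "k + n"] by (simp add: norm_trace_class_op_def power_add mult.commute)
    have geo: "(\<lambda>k. (1/2) ^ n * (1/2) ^ k) sums ((1/2) ^ n * 2 :: real)"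
      using sums_mult[OF geometric_sums[of "1/2 :: real"], of "(1/2) ^ n"] by simp
    have s: "summable (\<lambda>k. trace_norm (op_of (Y (k + n))))"
      by (rule summable_comparison_test'[OF sums_summable[OF geo]])
        (simp only: real_norm_def abs_of_nonneg[OF trace_norm_nonneg[OF trace_class_op_of]] nY)
    have "(\<lambda>k. op_of (X (r (k + n)))) \<longlonglongrightarrow> L"
      using Lr by (rule LIMSEQ_ignore_initial_segment)
    from telescope_sums[OF this]
    have "(\<lambda>k. op_of (Y (k + n))) sums (L - op_of (X (r n)))"
      by (simp add: Y_def op_of_simps)
    then have "(\<lambda>k. blinfun_apply (op_of (Y (k + n))) x) sums blinfun_apply (L - op_of (X (r n))) x" for x
      by (rule bounded_linear.sums[OF blinfun.bounded_linear_left])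
    then have *: "trace_class (L - op_of (X (r n))) \<and> trace_norm (L - op_of (X (r n)))
        \<le> (\<Sum>k. trace_norm (op_of (Y (k + n))))"
      by (intro trace_class_sums s) auto
    have "(\<Sum>k. trace_norm (op_of (Y (k + n)))) \<le> (\<Sum>k. (1/2) ^ n * (1/2) ^ k)"
      by (rule suminf_le[OF nY s sums_summable[OF geo]])
    with * geo show ?thesis by (simp add: sums_iff)
  qed
  have "trace_class L"
    using trace_class_add[of "L - op_of (X (r 0))" "op_of (X (r 0))"] tail[of 0] by simp
  then have LL: "op_of (tc_of L) = L" by (rule op_of_tc_of)
  have dr: "norm (X (r n) - tc_of L) \<le> 2 * (1/2) ^ n" for n
    using tail[of n] by (subst norm_minus_commute) (simp add: norm_trace_class_op_def op_of_simps LL)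
  have z: "(\<lambda>n. 2 * (1/2 :: real) ^ n) \<longlonglongrightarrow> 0"
    using tendsto_mult[OF tendsto_const[of 2] LIMSEQ_power_zero[of "1/2 :: real"]] by simp
  have "(\<lambda>n. X (r n) - tc_of L) \<longlonglongrightarrow> 0"
    by (rule Lim_null_comparison[OF always_eventually z]) (simp add: dr)
  then have "(X \<circ> r) \<longlonglongrightarrow> tc_of L"
    by (simp add: LIM_zero_iff o_def)
  then show "convergent X"
    using Cauchy_converges_subseq[OF C r] by (auto simp: convergent_def)
qed

lemma bounded_bilinear_rank_one:
  "bounded_bilinear (\<lambda>a b :: 'a::{real_inner,banach}. tc_of (Blinfun (\<lambda>x. (a \<bullet> x) *\<^sub>R b)))"
  (is "bounded_bilinear ?R")
proof -
  have op: "blinfun_apply (op_of (?R a b)) x = (a \<bullet> x) *\<^sub>R b" for a b x :: 'a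
    by (simp add: op_of_tc_of rank_one)
  have eqI: "A = B" if "\<And>x. blinfun_apply (op_of A) x = blinfun_apply (op_of B) x" for A B :: "'a trace_class_op"
    using that by (simp flip: op_of_inject add: blinfun_eqI)
  show ?thesis
  proof
    fix a a' b b' :: 'a and r :: real
    show "?R (a + a') b = ?R a b + ?R a' b" "?R a (b + b') = ?R a b + ?R a b'"
      "?R (r *\<^sub>R a) b = r *\<^sub>R ?R a b" "?R a (r *\<^sub>R b) = r *\<^sub>R ?R a b"
      by (rule eqI, simp only: op op_of_simps blinfun.add_left blinfun.scaleR_left,
          simp add: inner_add_left scaleR_add_left scaleR_add_right)+
    have "norm (?R a b) \<le> norm a * norm b" for a b :: 'a
      by (simp add: norm_trace_class_op_def op_of_tc_of rank_one)
    then show "\<exists>K. \<forall>a b :: 'a. norm (?R a b) \<le> norm a * norm b * K"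
      by (intro exI[of _ 1]) simp
  qed
qed

lemma second_countable_from_dense:
  fixes S :: "'b::metric_space set"
  assumes S: "countable S" "closure S = UNIV"
  shows "\<exists>B :: 'b set set. countable B \<and> open = generate_topology B"
proof -
  define B where "B = (\<lambda>(x, q). ball x q) ` (S \<times> (\<rat> \<inter> {0<..}))"
  have "topological_basis B"
  proof (rule topological_basisI)
    fix U :: "'b set" and x assume U: "open U" "x \<in> U"
    then obtain e where e: "e > 0" "ball x e \<subseteq> U" by (meson openE)
    obtain q where q: "q \<in> \<rat>" "0 < q" "q < e / 2" using Rats_dense_in_real[of 0 "e/2"] e by auto
    have "x \<in> closure S" using S by simp
    then obtain y where y: "y \<in> S" "dist y x < q" using q(2) by (meson closure_approachable)
    have "ball y q \<subseteq> U"
    proof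
      fix z assume "z \<in> ball y q"
      then have "dist x z < e"
        using dist_triangle[of x z y] y(2) q(3) by (simp add: dist_commute)
      then show "z \<in> U" using e(2) by auto
    qed
    then show "\<exists>B'\<in>B. x \<in> B' \<and> B' \<subseteq> U"
      using y q by (auto simp: B_def intro!: bexI[of _ "(y, q)"])
  qed (auto simp: B_def)
  moreover have "countable B"
    unfolding B_def using S(1) countable_rat by (intro countable_image countable_SIGMA) auto
  ultimately show ?thesis using topological_basis_imp_subbasis by blast
qed

instance trace_class_op :: ("{real_inner,banach,second_countable_topology}") second_countable_topology
proof
  let ?R = "\<lambda>a b :: 'a. tc_of (Blinfun (\<lambda>x. (a \<bullet> x) *\<^sub>R b))"
  interpret R: bounded_bilinear ?R by (rule bounded_bilinear_rank_one)
  obtain D :: "'a set" where D: "countable D" "\<And>U. open U \<Longrightarrow> U \<noteq> {} \<Longrightarrow> \<exists>d\<in>D. d \<in> U"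
    using countable_dense_setE by blast
  have clD: "closure D = UNIV"
  proof -
    have "x \<in> closure D" for x
      unfolding closure_approachable
    proof (intro allI impI)
      fix e :: real assume "0 < e"
      then show "\<exists>y\<in>D. dist y x < e" using D(2)[of "ball x e"] by (auto simp: dist_commute)
    qed
    then show ?thesis by auto
  qed
  define S where "S = (\<lambda>l. \<Sum>(a, b)\<leftarrow>l. ?R a b) ` lists (D \<times> D)"
  have "countable S"
    unfolding S_def using D(1) by (intro countable_image countable_lists countable_SIGMA) auto
  have S0: "0 \<in> S" unfolding S_def by (rule image_eqI[of _ _ "[]"]) auto
  have S_add: "A + B \<in> S" if "A \<in> S" "B \<in> S" for A B
  proof -
    from that obtain l l' where "l \<in> lists (D \<times> D)" "A = (\<Sum>(a, b)\<leftarrow>l. ?R a b)"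
      "l' \<in> lists (D \<times> D)" "B = (\<Sum>(a, b)\<leftarrow>l'. ?R a b)" by (auto simp: S_def)
    then show ?thesis unfolding S_def by (intro image_eqI[of _ _ "l @ l'"]) auto
  qed
  have cl_add: "A + B \<in> closure S" if AB: "A \<in> closure S" "B \<in> closure S" for A B
  proof -
    obtain f g where "\<And>n. f n \<in> S" "f \<longlonglongrightarrow> A" "\<And>n. g n \<in> S" "g \<longlonglongrightarrow> B"
      using AB unfolding closure_sequential by blast
    then show ?thesis
      unfolding closure_sequential by (intro exI[of _ "\<lambda>n. f n + g n"]) (auto intro: S_add tendsto_add)
  qed
  have cl_R: "?R a b \<in> closure S" for a b
  proof -
    have "a \<in> closure D" "b \<in> closure D" using clD by auto
    then obtain f g where fg: "\<And>n. f n \<in> D" "f \<longlonglongrightarrow> a" "\<And>n. g n \<in> D" "g \<longlonglongrightarrow> b"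
      unfolding closure_sequential by blast
    have "?R (f n) (g n) \<in> S" for n
      unfolding S_def using fg by (intro image_eqI[of _ _ "[(f n, g n)]"]) auto
    then show ?thesis
      unfolding closure_sequential using R.tendsto[OF fg(2) fg(4)]
      by (intro exI[of _ "\<lambda>n. ?R (f n) (g n)"]) auto
  qed
  have cl_sum: "(\<Sum>n<N. ?R (f n) (g n)) \<in> closure S" for f g :: "nat \<Rightarrow> 'a" and N :: nat
    by (induction N) (use S0 closure_subset cl_add cl_R in auto)
  have "A \<in> closure S" for A
  proof -
    obtain a b where ab: "nuclear_rep a b (op_of A)"
      using trace_class_op_of[of A] unfolding trace_class_def by blast
    have s: "summable (\<lambda>n. norm (a n) * norm (b n))"
      and A: "(\<lambda>n. (a n \<bullet> x) *\<^sub>R b n) sums blinfun_apply (op_of A) x" for x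
      using ab unfolding nuclear_rep_def by blast+
    have "norm (?R (a n) (b n)) \<le> norm (a n) * norm (b n)" for n
      by (simp add: norm_trace_class_op_def op_of_tc_of rank_one)
    then have sR: "summable (\<lambda>n. ?R (a n) (b n))"
      by (intro summable_norm_cancel[OF summable_comparison_test'[OF s]]) auto
    then obtain L where L: "(\<lambda>n. ?R (a n) (b n)) sums L" by (auto simp: summable_def)
    have bl: "bounded_linear (\<lambda>X :: 'a trace_class_op. blinfun_apply (op_of X) x)" for x
    proof
      fix X Y :: "'a trace_class_op" and r :: real
      show "blinfun_apply (op_of (X + Y)) x = blinfun_apply (op_of X) x + blinfun_apply (op_of Y) x"
        "blinfun_apply (op_of (r *\<^sub>R X)) x = r *\<^sub>R blinfun_apply (op_of X) x"
        by (simp_all add: op_of_simps blinfun.add_left blinfun.scaleR_left)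
      have "norm (blinfun_apply (op_of X) x) \<le> norm X * norm x" for X :: "'a trace_class_op"
        using order_trans[OF norm_blinfun mult_right_mono[OF norm_le_trace_norm[OF trace_class_op_of]]]
        by (simp add: norm_trace_class_op_def)
      then show "\<exists>K. \<forall>X. norm (blinfun_apply (op_of X) x) \<le> norm X * K" by blast
    qed
    have "L = A"
    proof -
      have "blinfun_apply (op_of L) x = blinfun_apply (op_of A) x" for x
        using sums_unique2[OF bounded_linear.sums[OF bl L, of x]] A[of x]
        by (simp add: op_of_tc_of rank_one)
      then show ?thesis by (simp flip: op_of_inject add: blinfun_eqI)
    qed
    then have "(\<lambda>N. \<Sum>n<N. ?R (a n) (b n)) \<longlonglongrightarrow> A" using L by (simp add: sums_def)
    then have "A \<in> closure (closure S)"
      unfolding closure_sequential[of A "closure S"] using cl_sum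
      by (intro exI[of _ "\<lambda>N. \<Sum>n<N. ?R (a n) (b n)"]) auto
    then show ?thesis by simp
  qed
  then have "closure S = UNIV" by auto
  with \<open>countable S\<close> show "\<exists>B :: 'a trace_class_op set set. countable B \<and> open = generate_topology B"
    by (rule second_countable_from_dense)
qed


section \<open>Symmetric and positive operators\<close>

text \<open>The library's \<open>adjoint\<close> is defined for maps between arbitrary real inner product spaces.
  For a bounded operator between Hilbert spaces it is again bounded, so that \<open>Blinfun\<close> applies.\<close>

definition blinfun_adjoint ::
    "('a::real_inner \<Rightarrow>\<^sub>L 'b::real_inner) \<Rightarrow> ('b \<Rightarrow>\<^sub>L 'a)" where
  "blinfun_adjoint A = Blinfun (adjoint (blinfun_apply A))"

definition sym_ops :: "('a::real_inner \<Rightarrow>\<^sub>L 'a) set" where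
  "sym_ops = {A. \<forall>x y. blinfun_apply A x \<bullet> y = x \<bullet> blinfun_apply A y}"

definition psd_ops :: "('a::real_inner \<Rightarrow>\<^sub>L 'a) set" where
  "psd_ops = {A \<in> sym_ops. \<forall>x. 0 \<le> blinfun_apply A x \<bullet> x}"

definition sqrt_op :: "('a::real_inner \<Rightarrow>\<^sub>L 'a) \<Rightarrow> ('a \<Rightarrow>\<^sub>L 'a)" where
  "sqrt_op Q = (THE R. R \<in> psd_ops \<and> R o\<^sub>L R = Q)"

text \<open>The pseudoinverse \<open>(R restricted to (ker R)\<^sup>\<bottom>)\<^sup>-\<^sup>1\<close>, meaningful on the range of \<open>R\<close>.\<close>

definition pseudoinverse :: "('a::real_inner \<Rightarrow>\<^sub>L 'a) \<Rightarrow> 'a \<Rightarrow> 'a" where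
  "pseudoinverse R u =
     (THE x. blinfun_apply R x = u \<and> (\<forall>y. blinfun_apply R y = 0 \<longrightarrow> x \<bullet> y = 0))"

section \<open>The space \<open>U\<^sub>0\<close> and Hilbert-Schmidt operators on it\<close>

text \<open>\<open>U\<^sub>0\<close> depends on the operator \<open>Q\<close> and carries its own inner product, so it is a subset of the
  type of \<open>U\<close> rather than a type. Accordingly an operator from \<open>U\<^sub>0\<close> to a Hilbert space is a function
  on all of \<open>U\<close> of which only the values on \<open>U\<^sub>0\<close> matter.\<close>

definition U0 :: "('u::real_inner \<Rightarrow>\<^sub>L 'u) \<Rightarrow> 'u set" where
  "U0 Q = range (blinfun_apply (sqrt_op Q))"

definition U0_inner :: "('u::real_inner \<Rightarrow>\<^sub>L 'u) \<Rightarrow> 'u \<Rightarrow> 'u \<Rightarrow> real" where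
  "U0_inner Q u v = pseudoinverse (sqrt_op Q) u \<bullet> pseudoinverse (sqrt_op Q) v"

definition U0_orthonormal_basis :: "('u::real_inner \<Rightarrow>\<^sub>L 'u) \<Rightarrow> 'u set \<Rightarrow> bool" where
  "U0_orthonormal_basis Q E \<longleftrightarrow> E \<subseteq> U0 Q \<and>
     (\<forall>e\<in>E. \<forall>f\<in>E. U0_inner Q e f = (if e = f then 1 else 0)) \<and>
     (\<forall>u\<in>U0 Q. (\<forall>e\<in>E. U0_inner Q u e = 0) \<longrightarrow> u = 0)"

definition hilbert_schmidt ::
    "('u::real_inner \<Rightarrow>\<^sub>L 'u) \<Rightarrow> ('u \<Rightarrow> 'a::real_inner) \<Rightarrow> bool" where
  "hilbert_schmidt Q A \<longleftrightarrow>
     (\<forall>u\<in>U0 Q. \<forall>v\<in>U0 Q. A (u + v) = A u + A v) \<and>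
     (\<forall>u\<in>U0 Q. \<forall>c. A (c *\<^sub>R u) = c *\<^sub>R A u) \<and>
     (\<exists>M. \<forall>u\<in>U0 Q. norm (A u) \<le> M * sqrt (U0_inner Q u u)) \<and>
     (\<forall>E. U0_orthonormal_basis Q E \<longrightarrow> (\<lambda>e. (norm (A e))\<^sup>2) summable_on E)"

text \<open>The sum does not depend on the orthonormal basis.\<close>

definition hs_norm ::
    "('u::real_inner \<Rightarrow>\<^sub>L 'u) \<Rightarrow> ('u \<Rightarrow> 'a::real_inner) \<Rightarrow> real" where
  "hs_norm Q A = sqrt (\<Sum>\<^sub>\<infinity>e\<in>(SOME E. U0_orthonormal_basis Q E). (norm (A e))\<^sup>2)"

definition U0_adjoint ::
    "('u::real_inner \<Rightarrow>\<^sub>L 'u) \<Rightarrow> ('u \<Rightarrow> 'a::real_inner) \<Rightarrow> 'a \<Rightarrow> 'u" where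
  "U0_adjoint Q A x = (THE v. v \<in> U0 Q \<and> (\<forall>u\<in>U0 Q. U0_inner Q v u = x \<bullet> A u))"

section \<open>The integral equation\<close>

text \<open>The family \<open>S\<close> restricted to \<open>H\<close>. The embedding of \<open>H\<close> into the larger space is \<open>\<iota>\<close>;
  \<open>S\<^sub>0\<close> is the value of the family at time \<open>0\<close>, which is defined on \<open>H\<close> only, and \<open>S t\<close> is used for
  \<open>t > 0\<close> only.\<close>

definition on_H ::
    "('h::real_normed_vector \<Rightarrow>\<^sub>L 'k::real_normed_vector) \<Rightarrow> ('h \<Rightarrow>\<^sub>L 'h) \<Rightarrow>
     (real \<Rightarrow> 'k \<Rightarrow>\<^sub>L 'h) \<Rightarrow> real \<Rightarrow> ('h \<Rightarrow>\<^sub>L 'h)" where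
  "on_H \<iota> S\<^sub>0 S t = (if t = 0 then S\<^sub>0 else S t o\<^sub>L \<iota>)"

definition drift_term ::
    "('h::{real_inner,banach} \<Rightarrow>\<^sub>L 'k::real_normed_vector) \<Rightarrow> ('h \<Rightarrow>\<^sub>L 'h) \<Rightarrow>
     (real \<Rightarrow> 'k \<Rightarrow>\<^sub>L 'h) \<Rightarrow> ('h \<Rightarrow>\<^sub>L 'k) \<Rightarrow> real \<Rightarrow> 'h trace_class_op \<Rightarrow> 'h trace_class_op" where
  "drift_term \<iota> S\<^sub>0 S F r X =
     tc_of (S r o\<^sub>L F o\<^sub>L op_of X o\<^sub>L blinfun_adjoint (on_H \<iota> S\<^sub>0 S r)) +
     tc_of (on_H \<iota> S\<^sub>0 S r o\<^sub>L op_of X o\<^sub>L blinfun_adjoint (S r o\<^sub>L F))"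

definition noise_term ::
    "('u::real_inner \<Rightarrow>\<^sub>L 'u) \<Rightarrow> (real \<Rightarrow> 'k::real_normed_vector \<Rightarrow>\<^sub>L 'h::{real_inner,banach}) \<Rightarrow>
     ('u \<Rightarrow> 'k) \<Rightarrow> real \<Rightarrow> 'h trace_class_op" where
  "noise_term Q S B r =
     tc_of (Blinfun (\<lambda>x. blinfun_apply (S r)
       (B (U0_adjoint Q (\<lambda>u. blinfun_apply (S r) (B u)) x))))"

text \<open>The Bochner integrals are over the open interval from \<open>0\<close> to \<open>t\<close>: at \<open>s = t\<close> the integrands would
  involve \<open>S 0\<close> off \<open>H\<close>.\<close>

definition lyapunov_solution where
  "lyapunov_solution T \<iota> Q S\<^sub>0 S F B Q\<^sub>\<xi> (K :: real \<Rightarrow>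
      'h::{real_inner,banach,second_countable_topology} trace_class_op) \<longleftrightarrow>
     continuous_on {0..T} K \<and>
     (\<forall>t\<in>{0..T}.
       set_integrable lebesgue {0<..<t} (\<lambda>s. drift_term \<iota> S\<^sub>0 S F (t - s) (K s)) \<and>
       set_integrable lebesgue {0<..<t} (\<lambda>s. noise_term Q S B (t - s)) \<and>
       K t = tc_of (on_H \<iota> S\<^sub>0 S t o\<^sub>L op_of Q\<^sub>\<xi> o\<^sub>L blinfun_adjoint (on_H \<iota> S\<^sub>0 S t)) +
         (LINT s:{0<..<t}|lebesgue. drift_term \<iota> S\<^sub>0 S F (t - s) (K s)) +
         (LINT s:{0<..<t}|lebesgue. noise_term Q S B (t - s)))"

end

theory Submission
  imports Defs
begin

text \<open>
  After the substitution \<open>r = t - s\<close> the equation is a linear Volterra equation of convolution type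
  in the Banach space \<open>\<L>\<^sub>1(H)\<close>,
  \<open>K(t) = g(t) + \<integral>\<^sub>0\<^sup>t L(r) K(t - r) dr\<close> with \<open>L(r) X = S(r) F X S(r)\<^sup>* + S(r) X (S(r) F)\<^sup>*\<close>.
  The trace class operators form an ideal (\<open>norm_sandwich_le\<close>), so \<open>\<parallel>L(r)\<parallel> \<le> 2 C a(r)\<close>, which is integrable.
  Multiplying the unknown by \<open>exp (- \<mu> t)\<close> multiplies the kernel by \<open>exp (- \<mu> r)\<close>; for large \<open>\<mu>\<close> the
  kernel has integral at most \<open>1/2\<close> (\<open>exp_weight\<close>), and Banach's fixed point theorem gives existence,
  while a maximum argument gives uniqueness (\<open>solution_exists\<close>, \<open>solution_unique\<close>). In the form with
  \<open>K(t - r)\<close> the continuity of the integral in \<open>t\<close> is inherited from \<open>K\<close> by dominated convergence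
  (\<open>continuous_truncated_integral\<close>).

  The data are handled through nuclear representations. If \<open>X = \<Sum>n. a n \<otimes> b n\<close>, then
  \<open>A X D\<^sup>* = \<Sum>n. D (a n) \<otimes> A (b n)\<close> in trace norm, which turns strong measurability or strong
  continuity of \<open>A\<close> and \<open>D\<close> into measurability or continuity in \<open>\<L>\<^sub>1(H)\<close> (\<open>measurable_sandwich\<close>,
  \<open>continuous_on_sandwich\<close>). If \<open>A\<close>, \<open>A'\<close> are Hilbert-Schmidt on \<open>U\<^sub>0\<close> and \<open>e\<close> runs through an
  orthonormal basis, then \<open>A A'\<^sup>* = \<Sum>e. A' e \<otimes> A e\<close>, so its trace norm is at most the product of the
  Hilbert-Schmidt norms (\<open>norm_hs_prod_le\<close>). Hence the noise term is continuous on \<open>{0<..T}\<close> and bounded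
  by the integrable function \<open>(b r)\<^sup>2\<close>.

  Symmetry is a consequence of uniqueness: taking adjoints is a bounded linear map on \<open>\<L>\<^sub>1(H)\<close> that
  fixes \<open>g(t)\<close> and commutes with \<open>L(r)\<close>, so \<open>K(t)\<^sup>*\<close> solves the same equation as \<open>K(t)\<close>.
\<close>

section \<open>Orthogonality and adjoints in real Hilbert spaces\<close>

text \<open>The Riesz representation theorem on a closed subspace. The representing vector minimizes
  \<open>\<parallel>x\<parallel>\<^sup>2 - 2 f x\<close>; taking for \<open>f\<close> an inner product functional gives orthogonal projections.\<close>

lemma subspace_riesz:
  fixes V :: "'a::{real_inner,banach} set" and f :: "'a \<Rightarrow> real"
  assumes V: "subspace V" "closed V" and f: "bounded_linear f"
  obtains v where "v \<in> V" "\<And>y. y \<in> V \<Longrightarrow> v \<bullet> y = f y"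
proof -
  interpret f: bounded_linear f by (rule f)
  define J where "J x = (norm x)\<^sup>2 - 2 * f x" for x
  obtain M where M: "\<And>x. \<bar>f x\<bar> \<le> norm x * M" using f.bounded by auto
  have lower: "- M\<^sup>2 \<le> J x" for x
    using M[of x] zero_le_power2[of "norm x - M"] by (simp add: J_def power2_eq_square algebra_simps)
  define m where "m = Inf (J ` V)"
  have bdd: "bdd_below (J ` V)" using lower by (intro bdd_belowI2[of _ "- M\<^sup>2"])
  have m_le: "m \<le> J x" if "x \<in> V" for x
    unfolding m_def using bdd that by (rule cINF_lower)
  have "\<exists>x\<in>V. J x < m + 1 / real (Suc n)" for n
    using cINF_less_iff[of V J "m + 1 / real (Suc n)"] subspace_0[OF V(1)] bdd
    by (auto simp: m_def)
  then obtain X where X: "\<And>n. X n \<in> V" "\<And>n. J (X n) < m + 1 / real (Suc n)" by metis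
  \<comment> \<open>The linear part of \<open>J\<close> cancels in the parallelogram identity, so near-minimizers are close.\<close>
  have par: "(norm (x - y))\<^sup>2 = 2 * J x + 2 * J y - 4 * J ((1/2) *\<^sub>R (x + y))" for x y
    by (simp add: J_def power2_norm_eq_inner f.scaleR f.add inner_diff_left inner_diff_right
        inner_add_left inner_add_right inner_commute algebra_simps)
  have close: "(norm (X i - X j))\<^sup>2 < 2 / real (Suc i) + 2 / real (Suc j)" for i j
  proof -
    have "(1/2) *\<^sub>R (X i + X j) \<in> V" using V(1) X(1) by (intro subspace_scale subspace_add)
    from m_le[OF this] par[of "X i" "X j"] X(2)[of i] X(2)[of j] show ?thesis by linarith
  qed
  have "Cauchy X"
  proof (rule CauchyI)
    fix e :: real assume e: "0 < e"
    obtain N where N: "4 / real (Suc N) < e\<^sup>2"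
      using reals_Archimedean[of "e\<^sup>2 / 4"] e by (auto simp: field_simps)
    show "\<exists>N. \<forall>i\<ge>N. \<forall>j\<ge>N. norm (X i - X j) < e"
    proof (intro exI allI impI)
      fix i j assume "N \<le> i" "N \<le> j"
      then have "2 / real (Suc i) \<le> 2 / real (Suc N)" "2 / real (Suc j) \<le> 2 / real (Suc N)"
        by (simp_all add: frac_le)
      then have "(norm (X i - X j))\<^sup>2 < e\<^sup>2" using close[of i j] N by linarith
      then show "norm (X i - X j) < e" using e by (simp add: power2_less_imp_less)
    qed
  qed
  then obtain v where v: "X \<longlonglongrightarrow> v" using Cauchy_convergent_iff convergent_def by blast
  have vV: "v \<in> V" using closed_sequentially[OF V(2) X(1) v] .
  have "(\<lambda>n. J (X n)) \<longlonglongrightarrow> J v" unfolding J_def by (intro tendsto_intros v f.tendsto)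
  moreover have "(\<lambda>n. m + 1 / real (Suc n)) \<longlonglongrightarrow> m + 0"
    by (intro tendsto_intros LIMSEQ_Suc[OF lim_1_over_n])
  ultimately have "J v \<le> m"
    using LIMSEQ_le[of "\<lambda>n. J (X n)" "J v" "\<lambda>n. m + 1 / real (Suc n)" "m + 0"] X(2)
    by (auto intro: less_imp_le)
  then have min: "J v \<le> J x" if "x \<in> V" for x using m_le[OF that] by linarith
  have "v \<bullet> y = f y" if y: "y \<in> V" for y
  proof (rule ccontr)
    define c where "c = v \<bullet> y - f y"
    assume "v \<bullet> y \<noteq> f y"
    then have c: "c \<noteq> 0" by (simp add: c_def)
    then have y0: "y \<noteq> 0" by (auto simp: c_def f.zero)
    \<comment> \<open>The minimizer of the quadratic polynomial \<open>t \<mapsto> J (v + t y) - J v\<close>, whose value there is negative.\<close>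
    define t where "t = - c / (y \<bullet> y)"
    have "v + t *\<^sub>R y \<in> V" using V(1) vV y by (intro subspace_add subspace_scale)
    from min[OF this] have "0 \<le> t * t * (y \<bullet> y) + 2 * t * c"
      by (simp add: J_def c_def power2_norm_eq_inner f.add f.scaleR inner_add_left inner_add_right
          inner_commute algebra_simps)
    also have "\<dots> = - (c * c) / (y \<bullet> y)" using y0 by (simp add: t_def field_simps)
    finally have "c * c / (y \<bullet> y) \<le> 0" by simp
    moreover have "0 < c * c / (y \<bullet> y)"
      using c y0 by (intro divide_pos_pos) (auto simp: zero_less_mult_iff)
    ultimately show False by simp
  qed
  with vV show ?thesis by (rule that)
qed

text \<open>Riesz representation provides the vectors that the choice operator in \<open>adjoint\<close> has to pick,
  and the resulting map is bounded linear, as \<open>Blinfun\<close> requires.\<close>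

lemma inner_blinfun_adjoint:
  fixes A :: "'a::{real_inner,banach} \<Rightarrow>\<^sub>L 'b::real_inner"
  shows "x \<bullet> blinfun_apply (blinfun_adjoint A) y = blinfun_apply A x \<bullet> y"
proof -
  have "\<exists>v. \<forall>x. x \<bullet> v = blinfun_apply A x \<bullet> y" for y
    using subspace_riesz[of UNIV "\<lambda>x. blinfun_apply A x \<bullet> y"]
    by (metis UNIV_I bounded_linear_inner_left_comp blinfun.bounded_linear_right closed_UNIV
        inner_commute subspace_UNIV)
  then obtain g where g: "\<And>x y. x \<bullet> g y = blinfun_apply A x \<bullet> y" by metis
  have adj: "adjoint (blinfun_apply A) = g" by (rule adjoint_unique) (simp add: g)
  have "bounded_linear g"
  proof
    fix y z :: 'b and r :: real
    show "g (y + z) = g y + g z"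
      by (rule vector_eq_rdot[THEN iffD1]) (simp add: g inner_add_right inner_commute)
    show "g (r *\<^sub>R y) = r *\<^sub>R g y"
      by (rule vector_eq_rdot[THEN iffD1]) (simp add: g inner_commute)
    show "\<exists>K. \<forall>y. norm (g y) \<le> norm y * K"
    proof (intro exI allI)
      fix y
      have "norm (g y) * norm (g y) = blinfun_apply A (g y) \<bullet> y"
        using g[of "g y" y] by (simp flip: power2_eq_square power2_norm_eq_inner)
      also have "\<dots> \<le> (norm A * norm (g y)) * norm y"
        by (rule order_trans[OF norm_cauchy_schwarz mult_right_mono[OF norm_blinfun norm_ge_zero]])
      finally show "norm (g y) \<le> norm y * norm A"
        by (cases "norm (g y) = 0") (simp_all add: mult_ac)
    qed
  qed
  then show ?thesis
    by (simp add: blinfun_adjoint_def adj bounded_linear_Blinfun_apply g)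
qed

lemma inner_blinfun_adjoint_left:
  fixes A :: "'a::{real_inner,banach} \<Rightarrow>\<^sub>L 'b::real_inner"
  shows "blinfun_apply (blinfun_adjoint A) y \<bullet> x = y \<bullet> blinfun_apply A x"
  using inner_blinfun_adjoint[of x A y] by (simp add: inner_commute)

lemma blinfun_adjoint_eqI:
  fixes A :: "'a::{real_inner,banach} \<Rightarrow>\<^sub>L 'b::real_inner"
  assumes "\<And>x y. x \<bullet> blinfun_apply B y = blinfun_apply A x \<bullet> y"
  shows "blinfun_adjoint A = B"
  by (rule blinfun_eqI, rule vector_eq_ldot[THEN iffD1])
    (simp add: assms inner_blinfun_adjoint)

lemma blinfun_adjoint_adjoint:
  fixes A :: "'a::{real_inner,banach} \<Rightarrow>\<^sub>L 'b::{real_inner,banach}"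
  shows "blinfun_adjoint (blinfun_adjoint A) = A"
  by (rule blinfun_adjoint_eqI) (simp add: inner_blinfun_adjoint_left)

lemma orthogonal_projection_exists:
  fixes V :: "'a::{real_inner,banach} set"
  assumes "subspace V" "closed V"
  shows "\<exists>v\<in>V. \<forall>y\<in>V. (x - v) \<bullet> y = 0"
proof -
  have "bounded_linear (\<lambda>y. x \<bullet> y)" by (rule bounded_linear_inner_right)
  from subspace_riesz[OF assms this] show ?thesis
    by (metis diff_self inner_diff_left)
qed

text \<open>Allowing zero vectors among the \<open>e n\<close> covers finite and countably infinite orthonormal bases
  of \<open>W\<close> by one indexing. The partial sums are Cauchy by Bessel's inequality, and the difference of \<open>w\<close>
  and the limit is orthogonal to every \<open>e n\<close>.\<close>

lemma orthonormal_expansion: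
  fixes e :: "nat \<Rightarrow> 'a::{real_inner,banach}"
  assumes W: "subspace W" "closed W" and eW: "\<And>n. e n \<in> W"
    and orth: "\<And>m n. m \<noteq> n \<Longrightarrow> e m \<bullet> e n = 0"
    and nrm: "\<And>n. norm (e n) = 0 \<or> norm (e n) = 1"
    and complete: "\<And>w. w \<in> W \<Longrightarrow> (\<And>n. w \<bullet> e n = 0) \<Longrightarrow> w = 0"
    and w: "w \<in> W"
  shows "(\<lambda>n. (w \<bullet> e n) *\<^sub>R e n) sums w"
proof -
  let ?f = "\<lambda>n. (w \<bullet> e n) *\<^sub>R e n"
  have ee: "e n \<bullet> e n * (w \<bullet> e n) = w \<bullet> e n" for n
    using nrm[of n] by (auto simp: norm_eq_1)
  have pair: "pairwise (\<lambda>i j. orthogonal (?f i) (?f j)) I" for I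
    using orth by (auto simp: pairwise_def orthogonal_def)
  have sq: "(norm (?f n))\<^sup>2 = (w \<bullet> e n)\<^sup>2" for n
    using nrm[of n] by (auto simp: power_mult_distrib)
  have pyth: "(norm (sum ?f I))\<^sup>2 = (\<Sum>n\<in>I. (w \<bullet> e n)\<^sup>2)" if "finite I" for I
    unfolding norm_sum_Pythagorean[OF that pair] by (simp only: sq)
  have bessel: "(\<Sum>n\<in>I. (w \<bullet> e n)\<^sup>2) \<le> (norm w)\<^sup>2" if I: "finite I" for I
  proof -
    have "w \<bullet> sum ?f I = (\<Sum>n\<in>I. (w \<bullet> e n)\<^sup>2)"
      by (simp add: inner_sum_right power2_eq_square)
    then have "(norm (w - sum ?f I))\<^sup>2 = (norm w)\<^sup>2 - (\<Sum>n\<in>I. (w \<bullet> e n)\<^sup>2)"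
      using pyth[OF I]
      by (simp add: power2_norm_eq_inner inner_diff_left inner_diff_right inner_commute)
    then show ?thesis using zero_le_power2[of "norm (w - sum ?f I)"] by linarith
  qed
  have s2: "summable (\<lambda>n. (w \<bullet> e n)\<^sup>2)"
    by (rule summableI_nonneg_bounded[of _ "(norm w)\<^sup>2"]) (simp_all add: bessel)
  have "summable ?f"
    unfolding summable_Cauchy
  proof (intro allI impI)
    fix d :: real assume d: "0 < d"
    then have "0 < d\<^sup>2" by simp
    then obtain N where N: "\<And>m n. m \<ge> N \<Longrightarrow> norm (\<Sum>k=m..<n. (w \<bullet> e k)\<^sup>2) < d\<^sup>2"
      using s2 unfolding summable_Cauchy by meson
    have "norm (sum ?f {m..<n}) < d" if "m \<ge> N" for m n
    proof -
      have "(norm (sum ?f {m..<n}))\<^sup>2 < d\<^sup>2" using N[OF that, of n] pyth[of "{m..<n}"] by simp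
      then show ?thesis using d by (simp add: power2_less_imp_less)
    qed
    then show "\<exists>N. \<forall>m\<ge>N. \<forall>n. norm (sum ?f {m..<n}) < d" by blast
  qed
  then have sums: "?f sums suminf ?f" by (rule summable_sums)
  have "suminf ?f \<in> W"
  proof (rule closed_sequentially[OF W(2)])
    show "(\<lambda>n. sum ?f {..<n}) \<longlonglongrightarrow> suminf ?f" using sums by (simp add: sums_def)
    show "sum ?f {..<n} \<in> W" for n by (intro subspace_sum subspace_scale W(1) eW)
  qed
  then have dW: "w - suminf ?f \<in> W" using W(1) w by (simp add: subspace_diff)
  have "(w - suminf ?f) \<bullet> e n = 0" for n
  proof -
    have "(\<lambda>k. ?f k \<bullet> e n) sums (suminf ?f \<bullet> e n)"
      by (rule bounded_linear.sums[OF bounded_linear_inner_left sums])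
    moreover have "(\<lambda>k. ?f k \<bullet> e n) = (\<lambda>k. if k = n then w \<bullet> e k else 0)"
      using orth ee[of n] by (auto simp: fun_eq_iff mult.commute)
    ultimately have "(\<lambda>k. if k = n then w \<bullet> e k else 0) sums (suminf ?f \<bullet> e n)" by simp
    from sums_unique2[OF this sums_single] show ?thesis by (simp add: inner_diff_left)
  qed
  from complete[OF dW this] sums show ?thesis by simp
qed

section \<open>Operations on trace class operators\<close>

text \<open>The tensor \<open>a \<otimes> b\<close>, mapping \<open>x\<close> to \<open>(a \<bullet> x) b\<close>.\<close>

definition rank1 :: "'a \<Rightarrow> 'a \<Rightarrow> 'a::{real_inner,banach} trace_class_op" where
  "rank1 a b = tc_of (Blinfun (\<lambda>x. (a \<bullet> x) *\<^sub>R b))"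

interpretation rank1: bounded_bilinear "rank1 :: 'a::{real_inner,banach} \<Rightarrow> _"
  unfolding rank1_def by (rule bounded_bilinear_rank_one)

lemma op_of_rank1: "blinfun_apply (op_of (rank1 a b)) x = (a \<bullet> x) *\<^sub>R b"
  by (simp add: rank1_def op_of_tc_of rank_one)

lemma norm_rank1_le: "norm (rank1 a b) \<le> norm a * norm b"
  by (simp add: rank1_def norm_trace_class_op_def op_of_tc_of rank_one)

lemma trace_class_op_eqI:
  "A = B" if "\<And>x. blinfun_apply (op_of A) x = blinfun_apply (op_of B) x"
  using that by (simp flip: op_of_inject add: blinfun_eqI)

lemma bounded_linear_apply_op_of:
  "bounded_linear (\<lambda>X :: 'a::{real_inner,banach} trace_class_op. blinfun_apply (op_of X) x)"
proof
  fix X Y :: "'a trace_class_op" and r :: real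
  show "blinfun_apply (op_of (X + Y)) x = blinfun_apply (op_of X) x + blinfun_apply (op_of Y) x"
    "blinfun_apply (op_of (r *\<^sub>R X)) x = r *\<^sub>R blinfun_apply (op_of X) x"
    by (simp_all add: op_of_simps blinfun.add_left blinfun.scaleR_left)
  have "norm (blinfun_apply (op_of X) x) \<le> norm X * norm x" for X :: "'a trace_class_op"
    using order_trans[OF norm_blinfun mult_right_mono[OF norm_le_trace_norm[OF trace_class_op_of]]]
    by (simp add: norm_trace_class_op_def)
  then show "\<exists>K. \<forall>X. norm (blinfun_apply (op_of X) x) \<le> norm X * K" by blast
qed

lemma nuclear_rep_summable: "nuclear_rep a b Z \<Longrightarrow> summable (\<lambda>n. norm (a n) * norm (b n))"
  by (simp add: nuclear_rep_def)

lemma summable_norm_rank1: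
  assumes "summable (\<lambda>n. norm (a n) * norm (b n))"
  shows "summable (\<lambda>n. norm (rank1 (a n) (b n)))"
  by (rule summable_comparison_test'[OF assms]) (simp add: norm_rank1_le)

lemma nuclear_rep_imp_trace_class: "nuclear_rep a b Z \<Longrightarrow> trace_class Z"
  by (auto simp: trace_class_def)

text \<open>The defining pointwise convergence of a nuclear representation is automatically convergence in
  trace norm: the rank one terms are absolutely summable in the Banach space \<open>\<L>\<^sub>1(H)\<close>, and the limit is
  determined by its values.\<close>

lemma nuclear_rep_rank1_sums:
  fixes Z :: "'a::{real_inner,banach} \<Rightarrow>\<^sub>L 'a"
  assumes rep: "nuclear_rep a b Z"
  shows "(\<lambda>n. rank1 (a n) (b n)) sums tc_of Z"
proof -
  obtain L where L: "(\<lambda>n. rank1 (a n) (b n)) sums L"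
    using summable_norm_cancel[OF summable_norm_rank1[OF nuclear_rep_summable[OF rep]]]
    by (auto simp: summable_def)
  have "blinfun_apply (op_of L) x = blinfun_apply Z x" for x
    using bounded_linear.sums[OF bounded_linear_apply_op_of L, of x] rep
    by (auto simp: op_of_rank1 nuclear_rep_def intro: sums_unique2)
  then have "L = tc_of Z"
    by (intro trace_class_op_eqI) (simp add: op_of_tc_of nuclear_rep_imp_trace_class[OF rep])
  with L show ?thesis by simp
qed

lemma norm_tc_of_le:
  assumes "nuclear_rep a b Z"
  shows "norm (tc_of Z) \<le> (\<Sum>n. norm (a n) * norm (b n))"
  using trace_norm_le[OF assms]
  by (simp add: norm_trace_class_op_def op_of_tc_of nuclear_rep_imp_trace_class[OF assms])

lemma nuclear_rep_adjoint:
  fixes Z :: "'a::{real_inner,banach} \<Rightarrow>\<^sub>L 'a"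
  assumes rep: "nuclear_rep a b Z"
  shows "nuclear_rep b a (blinfun_adjoint Z)"
  unfolding nuclear_rep_def
proof (intro conjI allI)
  have s: "summable (\<lambda>n. norm (b n) * norm (a n))"
    using nuclear_rep_summable[OF rep] by (simp add: mult.commute)
  then show "summable (\<lambda>n. norm (b n) * norm (a n))" .
  fix x
  have "(\<lambda>n. op_of (rank1 (b n) (a n)) x) sums op_of (\<Sum>n. rank1 (b n) (a n)) x"
    by (intro bounded_linear.sums[OF bounded_linear_apply_op_of] summable_sums
        summable_norm_cancel[OF summable_norm_rank1[OF s]])
  then have sums: "(\<lambda>n. (b n \<bullet> x) *\<^sub>R a n) sums op_of (\<Sum>n. rank1 (b n) (a n)) x"
    by (simp add: op_of_rank1)
  have "y \<bullet> op_of (\<Sum>n. rank1 (b n) (a n)) x = y \<bullet> blinfun_adjoint Z x" for y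
  proof (rule sums_unique2)
    show "(\<lambda>n. y \<bullet> ((b n \<bullet> x) *\<^sub>R a n)) sums (y \<bullet> op_of (\<Sum>n. rank1 (b n) (a n)) x)"
      by (rule bounded_linear.sums[OF bounded_linear_inner_right sums])
    have "(\<lambda>n. (a n \<bullet> y) *\<^sub>R b n) sums Z y"
      using rep by (simp add: nuclear_rep_def)
    from bounded_linear.sums[OF bounded_linear_inner_left this, of x]
    show "(\<lambda>n. y \<bullet> ((b n \<bullet> x) *\<^sub>R a n)) sums (y \<bullet> blinfun_adjoint Z x)"
      by (simp add: inner_blinfun_adjoint inner_commute mult.commute)
  qed
  then have "op_of (\<Sum>n. rank1 (b n) (a n)) x = blinfun_adjoint Z x"
    by (subst vector_eq_ldot[symmetric]) simp
  with sums show "(\<lambda>n. (b n \<bullet> x) *\<^sub>R a n) sums blinfun_adjoint Z x" by simp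
qed

lemma nuclear_rep_sandwich:
  fixes Z :: "'a::{real_inner,banach} \<Rightarrow>\<^sub>L 'a" and A D :: "'a \<Rightarrow>\<^sub>L 'a"
  assumes rep: "nuclear_rep a b Z"
  shows "nuclear_rep (\<lambda>n. D (a n)) (\<lambda>n. A (b n)) (A o\<^sub>L Z o\<^sub>L blinfun_adjoint D)"
  unfolding nuclear_rep_def
proof (intro conjI allI)
  have "norm (D x) * norm (A y) \<le> norm D * norm A * (norm x * norm y)" for x y
    using mult_mono[OF norm_blinfun norm_blinfun, of D x A y] by (simp add: mult_ac)
  then show "summable (\<lambda>n. norm (D (a n)) * norm (A (b n)))"
    by (intro summable_comparison_test'[OF
          summable_mult[OF nuclear_rep_summable[OF rep], of "norm D * norm A"]]) simp
  fix x
  have "(\<lambda>n. (a n \<bullet> blinfun_adjoint D x) *\<^sub>R b n) sums Z (blinfun_adjoint D x)"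
    using rep by (simp add: nuclear_rep_def)
  from bounded_linear.sums[OF blinfun.bounded_linear_right this, of A]
  show "(\<lambda>n. (D (a n) \<bullet> x) *\<^sub>R A (b n)) sums blinfun_apply (A o\<^sub>L Z o\<^sub>L blinfun_adjoint D) x"
    by (simp add: inner_blinfun_adjoint blinfun.scaleR_right)
qed

text \<open>The building block \<open>A X D\<^sup>*\<close> of the drift term and of the initial term.\<close>

definition sandwich ::
    "('a \<Rightarrow>\<^sub>L 'a) \<Rightarrow> ('a \<Rightarrow>\<^sub>L 'a) \<Rightarrow> 'a::{real_inner,banach} trace_class_op \<Rightarrow> 'a trace_class_op" where
  "sandwich A D X = tc_of (A o\<^sub>L op_of X o\<^sub>L blinfun_adjoint D)"

lemma trace_class_op_rep:
  obtains a b where "nuclear_rep a b (op_of X)"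
  using trace_class_op_of[of X] unfolding trace_class_def by blast

lemma op_of_sandwich: "op_of (sandwich A D X) = A o\<^sub>L op_of X o\<^sub>L blinfun_adjoint D"
proof -
  obtain a b where "nuclear_rep a b (op_of X)" by (rule trace_class_op_rep)
  from nuclear_rep_sandwich[OF this, of D A] show ?thesis
    unfolding sandwich_def by (intro op_of_tc_of nuclear_rep_imp_trace_class)
qed

lemma norm_sandwich_le: "norm (sandwich A D X) \<le> norm A * norm D * norm X"
proof (rule field_le_epsilon)
  fix d :: real assume d: "0 < d"
  define c where "c = norm A * norm D"
  have c: "0 \<le> c" by (simp add: c_def)
  have "0 < d / (c + 1)" using c d by simp
  then obtain a b where ab: "nuclear_rep a b (op_of X)"
      "(\<Sum>n. norm (a n) * norm (b n)) < norm X + d / (c + 1)"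
    using trace_norm_approx[OF trace_class_op_of[of X]] unfolding norm_trace_class_op_def by metis
  note rep = nuclear_rep_sandwich[OF ab(1), of D A]
  have le: "norm (D x) * norm (A y) \<le> c * (norm x * norm y)" for x y
    using mult_mono[OF norm_blinfun norm_blinfun, of D x A y] by (simp add: c_def mult_ac)
  have "norm (sandwich A D X) \<le> (\<Sum>n. norm (D (a n)) * norm (A (b n)))"
    unfolding sandwich_def by (rule norm_tc_of_le[OF rep])
  also have "\<dots> \<le> (\<Sum>n. c * (norm (a n) * norm (b n)))"
    by (intro suminf_le le nuclear_rep_summable[OF rep] summable_mult nuclear_rep_summable[OF ab(1)])
  also have "\<dots> = c * (\<Sum>n. norm (a n) * norm (b n))"
    by (rule suminf_mult[OF nuclear_rep_summable[OF ab(1)]])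
  also have "\<dots> \<le> c * (norm X + d / (c + 1))"
    using ab(2) c by (intro mult_left_mono) auto
  also have "\<dots> \<le> c * norm X + d" using c d by (simp add: field_simps)
  finally show "norm (sandwich A D X) \<le> norm A * norm D * norm X + d" by (simp add: c_def)
qed

lemma bounded_linear_sandwich: "bounded_linear (sandwich A D)"
proof
  show "sandwich A D (X + Y) = sandwich A D X + sandwich A D Y"
    "sandwich A D (r *\<^sub>R X) = r *\<^sub>R sandwich A D X" for X Y r
    by (rule trace_class_op_eqI;
        simp add: op_of_sandwich op_of_simps blinfun.add_left blinfun.scaleR_left
          blinfun.add_right blinfun.scaleR_right)+
  show "\<exists>K. \<forall>X. norm (sandwich A D X) \<le> norm X * K"
    using norm_sandwich_le[of A D] by (intro exI[of _ "norm A * norm D"]) (simp add: mult.commute)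
qed

text \<open>A strongly measurable family need not be measurable for the operator norm; the nuclear
  expansion of \<open>X\<close> reduces the claim to vectors.\<close>

lemma measurable_sandwich:
  fixes A D :: "'m \<Rightarrow> 'a::{real_inner,banach,second_countable_topology} \<Rightarrow>\<^sub>L 'a"
  assumes [measurable]: "\<And>v. (\<lambda>r. A r v) \<in> borel_measurable M" "\<And>v. (\<lambda>r. D r v) \<in> borel_measurable M"
  shows "(\<lambda>r. sandwich (A r) (D r) X) \<in> borel_measurable M"
proof -
  obtain a b where rep: "nuclear_rep a b (op_of X)" by (rule trace_class_op_rep)
  have eq: "sandwich (A r) (D r) X = (\<Sum>n. rank1 (D r (a n)) (A r (b n)))" for r
    unfolding sandwich_def by (rule sums_unique[OF nuclear_rep_rank1_sums[OF nuclear_rep_sandwich[OF rep]]])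
  have [measurable]: "(\<lambda>r. rank1 (D r (a n)) (A r (b n))) \<in> borel_measurable M" for n
    by (rule borel_measurable_continuous_Pair) (auto intro!: continuous_intros rank1.continuous_on)
  show ?thesis unfolding eq by measurable
qed

text \<open>The uniform bound \<open>C\<close> makes the nuclear expansion converge uniformly on \<open>I\<close>, by the
  Weierstrass M-test, and each of its terms is continuous by strong continuity.\<close>

lemma continuous_on_sandwich:
  fixes A D :: "'m::topological_space \<Rightarrow> 'a::{real_inner,banach} \<Rightarrow>\<^sub>L 'a"
  assumes A: "\<And>v. continuous_on I (\<lambda>t. A t v)" "\<And>t. t \<in> I \<Longrightarrow> norm (A t) \<le> C"
    and D: "\<And>v. continuous_on I (\<lambda>t. D t v)" "\<And>t. t \<in> I \<Longrightarrow> norm (D t) \<le> C"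
  shows "continuous_on I (\<lambda>t. sandwich (A t) (D t) X)"
proof -
  obtain a b where rep: "nuclear_rep a b (op_of X)" by (rule trace_class_op_rep)
  let ?f = "\<lambda>n t. rank1 (D t (a n)) (A t (b n))"
  have eq: "sandwich (A t) (D t) X = (\<Sum>n. ?f n t)" for t
    unfolding sandwich_def by (rule sums_unique[OF nuclear_rep_rank1_sums[OF nuclear_rep_sandwich[OF rep]]])
  have "norm (?f n t) \<le> C * C * (norm (a n) * norm (b n))" if t: "t \<in> I" for n t
  proof -
    have C: "0 \<le> C" using A(2)[OF t] norm_ge_zero order_trans by blast
    have "norm (D t (a n)) \<le> C * norm (a n)"
      by (rule order_trans[OF norm_blinfun mult_right_mono[OF D(2)[OF t] norm_ge_zero]])
    moreover have "norm (A t (b n)) \<le> C * norm (b n)"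
      by (rule order_trans[OF norm_blinfun mult_right_mono[OF A(2)[OF t] norm_ge_zero]])
    ultimately have "norm (D t (a n)) * norm (A t (b n)) \<le> (C * norm (a n)) * (C * norm (b n))"
      using C by (intro mult_mono) auto
    with norm_rank1_le[of "D t (a n)" "A t (b n)"] show ?thesis
      by (simp add: mult_ac)
  qed
  then have ul: "uniform_limit I (\<lambda>n t. \<Sum>i<n. ?f i t) (\<lambda>t. \<Sum>i. ?f i t) sequentially"
    by (rule Weierstrass_m_test[OF _ summable_mult[OF nuclear_rep_summable[OF rep]]])
  show ?thesis
    unfolding eq
    by (rule uniform_limit_theorem[OF _ ul])
      (auto intro!: always_eventually continuous_intros rank1.continuous_on A D)
qed

definition tc_adj :: "'a::{real_inner,banach} trace_class_op \<Rightarrow> 'a trace_class_op" where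
  "tc_adj X = tc_of (blinfun_adjoint (op_of X))"

lemma op_of_tc_adj: "op_of (tc_adj X) = blinfun_adjoint (op_of X)"
proof -
  obtain a b where "nuclear_rep a b (op_of X)" by (rule trace_class_op_rep)
  from nuclear_rep_adjoint[OF this] show ?thesis
    unfolding tc_adj_def by (intro op_of_tc_of nuclear_rep_imp_trace_class)
qed

lemma norm_tc_adj_le: "norm (tc_adj X) \<le> norm X"
proof (rule field_le_epsilon)
  fix d :: real assume "0 < d"
  then obtain a b where ab: "nuclear_rep a b (op_of X)"
      "(\<Sum>n. norm (a n) * norm (b n)) < norm X + d"
    using trace_norm_approx[OF trace_class_op_of[of X]] unfolding norm_trace_class_op_def by metis
  have "norm (tc_adj X) \<le> (\<Sum>n. norm (b n) * norm (a n))"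
    unfolding tc_adj_def by (rule norm_tc_of_le[OF nuclear_rep_adjoint[OF ab(1)]])
  with ab(2) show "norm (tc_adj X) \<le> norm X + d" by (simp add: mult.commute)
qed

lemma bounded_linear_tc_adj:
  "bounded_linear (tc_adj :: 'a::{real_inner,banach} trace_class_op \<Rightarrow> 'a trace_class_op)"
proof
  show "tc_adj (X + Y) = tc_adj X + tc_adj Y" "tc_adj (r *\<^sub>R X) = r *\<^sub>R tc_adj X"
    for X Y :: "'a trace_class_op" and r
    unfolding op_of_inject[symmetric] op_of_tc_adj
    by (rule blinfun_adjoint_eqI; simp add: op_of_simps op_of_tc_adj blinfun.add_left
          blinfun.scaleR_left inner_add_left inner_add_right inner_blinfun_adjoint)+
  show "\<exists>K. \<forall>X :: 'a trace_class_op. norm (tc_adj X) \<le> norm X * K"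
    by (intro exI[of _ 1]) (simp add: norm_tc_adj_le)
qed

lemma tc_adj_sandwich: "tc_adj (sandwich A D X) = sandwich D A (tc_adj X)"
  unfolding op_of_inject[symmetric] op_of_tc_adj op_of_sandwich
  by (rule blinfun_adjoint_eqI)
    (simp add: blinfun_adjoint_adjoint flip: inner_blinfun_adjoint)

lemma tc_adj_eq_iff: "tc_adj X = X \<longleftrightarrow> op_of X \<in> sym_ops"
proof
  assume "tc_adj X = X"
  then have "blinfun_adjoint (op_of X) = op_of X" by (simp flip: op_of_tc_adj)
  then show "op_of X \<in> sym_ops"
    using inner_blinfun_adjoint[of _ "op_of X"] by (auto simp: sym_ops_def)
next
  assume "op_of X \<in> sym_ops"
  then have "blinfun_adjoint (op_of X) = op_of X"
    by (intro blinfun_adjoint_eqI) (simp add: sym_ops_def)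
  then show "tc_adj X = X" by (simp flip: op_of_inject add: op_of_tc_adj)
qed

section \<open>Hilbert-Schmidt operators on \<open>U\<^sub>0\<close>\<close>

text \<open>The orthogonal complement of the kernel. The space \<open>U\<^sub>0\<close> is the image of \<open>Q\<^sup>1\<^sup>/\<^sup>2\<close>, and its inner
  product is the one making \<open>Q\<^sup>1\<^sup>/\<^sup>2\<close> an isometric isomorphism from this complement onto \<open>U\<^sub>0\<close>.\<close>

definition coimage :: "('u::real_inner \<Rightarrow>\<^sub>L 'u) \<Rightarrow> 'u set" where
  "coimage R = {w. \<forall>y. R y = 0 \<longrightarrow> w \<bullet> y = 0}"

lemma subspace_coimage: "subspace (coimage R)"
  by (auto simp: coimage_def subspace_def inner_add_left)

lemma closed_coimage: "closed (coimage R)"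
proof -
  have eq: "coimage R = (\<Inter>y\<in>{y. R y = 0}. {w. w \<bullet> y = 0})"
    unfolding coimage_def by blast
  show ?thesis
    unfolding eq by (intro closed_INT ballI closed_Collect_eq continuous_intros)
qed

lemma coimage_inj:
  assumes "x \<in> coimage R" "y \<in> coimage R" "R x = R y"
  shows "x = y"
proof -
  have "x - y \<in> coimage R" by (rule subspace_diff[OF subspace_coimage assms(1,2)])
  moreover have "R (x - y) = 0" by (simp add: blinfun.diff_right assms(3))
  ultimately have "(x - y) \<bullet> (x - y) = 0" by (simp add: coimage_def)
  then show ?thesis by simp
qed

text \<open>Subtracting from \<open>x\<close> its projection onto the kernel gives the unique preimage of \<open>R x\<close> that is
  orthogonal to the kernel.\<close>

lemma pseudoinverse:
  fixes R :: "'u::{real_inner,banach} \<Rightarrow>\<^sub>L 'u"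
  shows pseudoinverse_mem: "pseudoinverse R (R x) \<in> coimage R"
    and apply_pseudoinverse: "R (pseudoinverse R (R x)) = R x"
proof -
  have sub: "subspace {y. R y = 0}"
    by (auto simp: subspace_def blinfun.add_right blinfun.scaleR_right)
  have cl: "closed {y. R y = 0}"
    by (intro closed_Collect_eq continuous_intros)
  obtain v where v: "v \<in> {y. R y = 0}" "\<forall>y\<in>{y. R y = 0}. (x - v) \<bullet> y = 0"
    using orthogonal_projection_exists[OF sub cl, of x] by (elim bexE)
  have *: "R (x - v) = R x \<and> (\<forall>y. R y = 0 \<longrightarrow> (x - v) \<bullet> y = 0)"
    using v by (simp add: blinfun.diff_right)
  have "pseudoinverse R (R x) = x - v"
    unfolding pseudoinverse_def
  proof (rule the_equality[where P = "\<lambda>z. R z = R x \<and> (\<forall>y. R y = 0 \<longrightarrow> z \<bullet> y = 0)", OF *])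
    fix z assume "R z = R x \<and> (\<forall>y. R y = 0 \<longrightarrow> z \<bullet> y = 0)"
    with * have "z \<in> coimage R" "x - v \<in> coimage R" "R z = R (x - v)"
      by (simp_all add: coimage_def)
    then show "z = x - v" by (rule coimage_inj)
  qed
  with * show "pseudoinverse R (R x) \<in> coimage R" "R (pseudoinverse R (R x)) = R x"
    by (simp_all add: coimage_def)
qed

lemma pseudoinverse_apply:
  fixes R :: "'u::{real_inner,banach} \<Rightarrow>\<^sub>L 'u"
  assumes "w \<in> coimage R" shows "pseudoinverse R (R w) = w"
  using coimage_inj[OF pseudoinverse_mem assms apply_pseudoinverse] .

lemma norm_pseudoinverse_le:
  fixes R :: "'u::{real_inner,banach} \<Rightarrow>\<^sub>L 'u"
  shows "norm (pseudoinverse R (R x)) \<le> norm x"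
proof -
  let ?p = "pseudoinverse R (R x)"
  have "?p \<bullet> (x - ?p) = 0"
    using pseudoinverse_mem[of R x] by (simp add: coimage_def blinfun.diff_right apply_pseudoinverse)
  then have "norm ?p * norm ?p = ?p \<bullet> x"
    by (simp add: inner_diff_right flip: power2_norm_eq_inner power2_eq_square)
  also have "\<dots> \<le> norm ?p * norm x" by (rule norm_cauchy_schwarz)
  finally show ?thesis by (cases "norm ?p = 0") simp_all
qed

lemma U0_inner_apply:
  fixes Q :: "'u::{real_inner,banach} \<Rightarrow>\<^sub>L 'u"
  assumes "v \<in> coimage (sqrt_op Q)" "w \<in> coimage (sqrt_op Q)"
  shows "U0_inner Q (sqrt_op Q v) (sqrt_op Q w) = v \<bullet> w"
  using assms by (simp add: U0_inner_def pseudoinverse_apply)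

lemma U0E:
  fixes Q :: "'u::{real_inner,banach} \<Rightarrow>\<^sub>L 'u"
  assumes "u \<in> U0 Q"
  obtains w where "w \<in> coimage (sqrt_op Q)" "u = sqrt_op Q w"
proof -
  obtain x where "u = sqrt_op Q x" using assms by (auto simp: U0_def)
  then have "u = sqrt_op Q (pseudoinverse (sqrt_op Q) (sqrt_op Q x))"
    by (simp only: apply_pseudoinverse)
  with pseudoinverse_mem show ?thesis by (rule that)
qed

lemma sqrt_op_in_U0: "sqrt_op Q x \<in> U0 Q"
  by (simp add: U0_def)

text \<open>A maximal orthonormal subset of \<open>U\<^sub>0\<close> is complete, since a vector orthogonal to it could be
  normalized and added. The existence gives \<open>hs_norm\<close> its meaning, as it sums over a chosen basis.\<close>

lemma U0_orthonormal_basis_exists: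
  fixes Q :: "'u::{real_inner,banach} \<Rightarrow>\<^sub>L 'u"
  shows "\<exists>E. U0_orthonormal_basis Q E"
proof -
  let ?R = "sqrt_op Q"
  define F where "F = {E. E \<subseteq> U0 Q \<and> (\<forall>e\<in>E. \<forall>f\<in>E. U0_inner Q e f = (if e = f then 1 else 0))}"
  have "\<exists>E\<in>F. \<forall>X\<in>F. E \<subseteq> X \<longrightarrow> X = E"
  proof (rule subset_Zorn_nonempty)
    have "{} \<in> F" by (simp add: F_def)
    then show "F \<noteq> {}" by blast
    fix C assume "C \<noteq> {}" and C: "subset.chain F C"
    then have CF: "C \<subseteq> F" by (simp add: subset_chain_def)
    show "\<Union>C \<in> F"
      unfolding F_def
    proof (intro CollectI conjI ballI)
      show "\<Union>C \<subseteq> U0 Q" using CF by (auto simp: F_def)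
      fix e f assume "e \<in> \<Union>C" "f \<in> \<Union>C"
      then obtain X where "X \<in> C" "e \<in> X" "f \<in> X"
        using C unfolding subset_chain_def by (metis UnionE subsetD)
      then show "U0_inner Q e f = (if e = f then 1 else 0)" using CF by (auto simp: F_def)
    qed
  qed
  then obtain E where E: "E \<in> F" and max: "\<And>X. X \<in> F \<Longrightarrow> E \<subseteq> X \<Longrightarrow> X = E" by blast
  have EU: "E \<subseteq> U0 Q" and Eon: "\<And>e f. e \<in> E \<Longrightarrow> f \<in> E \<Longrightarrow> U0_inner Q e f = (if e = f then 1 else 0)"
    using E by (auto simp: F_def)
  have "u = 0" if u: "u \<in> U0 Q" and perp: "\<And>e. e \<in> E \<Longrightarrow> U0_inner Q u e = 0" for u
  proof (rule ccontr)
    assume "u \<noteq> 0"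
    obtain w where w: "w \<in> coimage ?R" "u = ?R w" by (rule U0E[OF u])
    with \<open>u \<noteq> 0\<close> have w0: "w \<noteq> 0" by (auto simp: blinfun.zero_right)
    define w' where "w' = (1 / norm w) *\<^sub>R w"
    have w': "w' \<in> coimage ?R" unfolding w'_def by (rule subspace_scale[OF subspace_coimage w(1)])
    have self: "U0_inner Q (?R w') (?R w') = 1"
      unfolding U0_inner_apply[OF w' w'] norm_eq_1[symmetric] using w0 by (simp add: w'_def)
    have perp': "U0_inner Q (?R w') e = 0" "U0_inner Q e (?R w') = 0" if e: "e \<in> E" for e
    proof -
      obtain z where z: "z \<in> coimage ?R" "e = ?R z" using U0E EU e by blast
      have "w \<bullet> z = 0" using perp[OF e] w z by (simp add: U0_inner_apply)
      then show "U0_inner Q (?R w') e = 0" "U0_inner Q e (?R w') = 0"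
        using z w' by (simp_all add: U0_inner_apply, simp_all add: w'_def inner_commute)
    qed
    have notin: "?R w' \<notin> E" using perp'(1)[of "?R w'"] self by auto
    then have ne: "?R w' \<noteq> e" "e \<noteq> ?R w'" if "e \<in> E" for e using that by auto
    have "insert (?R w') E \<in> F"
      unfolding F_def
    proof (intro CollectI conjI ballI)
      show "insert (?R w') E \<subseteq> U0 Q" using EU sqrt_op_in_U0 by blast
      show "U0_inner Q e f = (if e = f then 1 else 0)"
        if "e \<in> insert (?R w') E" "f \<in> insert (?R w') E" for e f
        using that by (elim insertE) (simp_all add: self perp' Eon ne)
    qed
    then show False using max[of "insert (?R w') E"] notin by blast
  qed
  then have "U0_orthonormal_basis Q E"
    using EU Eon by (simp add: U0_orthonormal_basis_def)
  then show ?thesis ..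
qed

text \<open>Distinct basis vectors are pulled back to points at distance \<open>\<surd>2\<close>, and a separable space
  contains only countably many disjoint balls.\<close>

lemma countable_U0_orthonormal_basis:
  fixes Q :: "'u::{real_inner,banach,second_countable_topology} \<Rightarrow>\<^sub>L 'u"
  assumes "U0_orthonormal_basis Q E"
  shows "countable E"
proof -
  let ?p = "pseudoinverse (sqrt_op Q)"
  have dist: "1 < dist (?p e) (?p f)" if "e \<in> E" "f \<in> E" "e \<noteq> f" for e f
  proof -
    have "(dist (?p e) (?p f))\<^sup>2 = 2"
      using assms that
      by (simp add: U0_orthonormal_basis_def U0_inner_def dist_norm power2_norm_eq_inner
          inner_diff_left inner_diff_right)
    then have "1\<^sup>2 < (dist (?p e) (?p f))\<^sup>2" by simp
    then show ?thesis by (rule power2_less_imp_less) simp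
  qed
  have disj: "ball (?p e) (1/2) \<inter> ball (?p f) (1/2) = {}" if "e \<in> E" "f \<in> E" "e \<noteq> f" for e f
    using dist[OF that] by (intro disjoint_ballI) simp
  have "inj_on (\<lambda>e. ball (?p e) (1/2)) E"
    by (rule inj_onI) (metis disj Int_absorb ball_eq_empty not_le half_gt_zero zero_less_one)
  moreover have "countable ((\<lambda>e. ball (?p e) (1/2)) ` E)"
    by (rule countable_disjoint_open_subsets)
      (use disj in \<open>auto simp: disjoint_def\<close>)
  ultimately show ?thesis by (rule countable_image_inj_on[rotated])
qed

lemma hilbert_schmidt_zero:
  assumes "hilbert_schmidt Q A"
  shows "A 0 = 0"
proof -
  have "\<forall>u\<in>U0 Q. \<forall>c. A (c *\<^sub>R u) = c *\<^sub>R A u"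
    using assms by (simp add: hilbert_schmidt_def)
  from bspec[OF this sqrt_op_in_U0[of Q 0], THEN spec, of 0] show ?thesis by simp
qed

text \<open>The chosen basis of \<open>U\<^sub>0\<close>, pulled back to the orthogonal complement of the kernel, enumerated by
  the natural numbers and padded with zeros, so that \<open>orthonormal_expansion\<close> and nuclear
  representations, which are indexed by the natural numbers, apply.\<close>

lemma U0_basis_sequence:
  fixes Q :: "'u::{real_inner,banach,second_countable_topology} \<Rightarrow>\<^sub>L 'u"
  obtains e :: "nat \<Rightarrow> 'u" where
    "\<forall>n. e n \<in> coimage (sqrt_op Q)"
    "\<forall>m n. m \<noteq> n \<longrightarrow> e m \<bullet> e n = 0"
    "\<forall>n. norm (e n) = 0 \<or> norm (e n) = 1"
    "\<forall>w\<in>coimage (sqrt_op Q). (\<forall>n. w \<bullet> e n = 0) \<longrightarrow> w = 0"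
    "\<forall>A :: 'u \<Rightarrow> 'a::real_inner. hilbert_schmidt Q A \<longrightarrow>
       (\<lambda>n. (norm (A (sqrt_op Q (e n))))\<^sup>2) sums (hs_norm Q A)\<^sup>2"
proof -
  let ?R = "sqrt_op Q" and ?p = "pseudoinverse (sqrt_op Q)"
  define E where "E = (SOME E. U0_orthonormal_basis Q E)"
  have E: "U0_orthonormal_basis Q E"
    unfolding E_def by (rule someI_ex[OF U0_orthonormal_basis_exists])
  have cE: "countable E" by (rule countable_U0_orthonormal_basis[OF E])
  have EU: "f \<in> U0 Q" if "f \<in> E" for f using E that by (auto simp: U0_orthonormal_basis_def)
  have ip: "?p f \<bullet> ?p g = (if f = g then 1 else 0)" if "f \<in> E" "g \<in> E" for f g
    using E that by (auto simp: U0_orthonormal_basis_def U0_inner_def)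
  \<comment> \<open>The set \<open>I\<close> is an initial segment if \<open>E\<close> is finite and all of the natural numbers otherwise.\<close>
  define I where "I = to_nat_on E ` E"
  define e where "e n = (if n \<in> I then ?p (from_nat_into E n) else 0)" for n
  have in_E: "from_nat_into E n \<in> E" if "n \<in> I" for n
    using that cE by (auto simp: I_def)
  have inj: "from_nat_into E m \<noteq> from_nat_into E n" if "m \<in> I" "n \<in> I" "m \<noteq> n" for m n
    using that cE by (auto simp: I_def)
  show ?thesis
  proof (rule that; intro allI ballI impI)
    have "?p f \<in> coimage ?R" if "f \<in> E" for f
      using EU[OF that] pseudoinverse_mem by (auto simp: U0_def)
    then show "e n \<in> coimage ?R" for n
      using in_E subspace_0[OF subspace_coimage] by (auto simp: e_def)
    show "e m \<bullet> e n = 0" if "m \<noteq> n" for m n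
      using ip[OF in_E in_E] inj[OF _ _ that] by (auto simp: e_def)
    show "norm (e n) = 0 \<or> norm (e n) = 1" for n
      using ip[OF in_E in_E, of n n] by (auto simp: e_def norm_eq_1)
    show "w = 0" if w: "w \<in> coimage ?R" and perp: "\<forall>n. w \<bullet> e n = 0" for w
    proof -
      have "U0_inner Q (?R w) f = 0" if f: "f \<in> E" for f
      proof -
        have "e (to_nat_on E f) = ?p f" using f cE by (simp add: e_def I_def)
        then show ?thesis
          using perp[THEN spec, of "to_nat_on E f"] by (simp add: U0_inner_def pseudoinverse_apply[OF w])
      qed
      then have "?R w = ?R 0"
        using E sqrt_op_in_U0[of Q w] by (simp add: U0_orthonormal_basis_def blinfun.zero_right)
      then show ?thesis
        by (rule coimage_inj[OF w subspace_0[OF subspace_coimage]])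
    qed
    fix A :: "'u \<Rightarrow> 'a" assume A: "hilbert_schmidt Q A"
    let ?s = "\<Sum>\<^sub>\<infinity>f\<in>E. (norm (A f))\<^sup>2"
    have Rp: "?R (?p f) = f" if "f \<in> E" for f
      using EU[OF that] apply_pseudoinverse by (auto simp: U0_def)
    have "((\<lambda>f. (norm (A f))\<^sup>2) has_sum ?s) E"
      using A E unfolding hilbert_schmidt_def by (intro has_sum_infsum) blast
    then have "(((\<lambda>n. (norm (A (?R (e n))))\<^sup>2) \<circ> to_nat_on E) has_sum ?s) E"
      by (rule has_sum_cong[THEN iffD1, rotated]) (use cE Rp in \<open>simp add: e_def I_def\<close>)
    then have "((\<lambda>n. (norm (A (?R (e n))))\<^sup>2) has_sum ?s) I"
      unfolding I_def using inj_on_to_nat_on[OF cE] by (simp add: has_sum_reindex)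
    then have "((\<lambda>n. (norm (A (?R (e n))))\<^sup>2) has_sum ?s) UNIV"
      by (rule has_sum_cong_neutral[THEN iffD1, rotated -1])
        (use hilbert_schmidt_zero[OF A] in \<open>auto simp: e_def blinfun.zero_right\<close>)
    moreover have "(hs_norm Q A)\<^sup>2 = ?s"
      unfolding hs_norm_def E_def[symmetric] by (simp add: infsum_nonneg)
    ultimately show "(\<lambda>n. (norm (A (?R (e n))))\<^sup>2) sums (hs_norm Q A)\<^sup>2"
      by (simp add: has_sum_imp_sums)
  qed
qed

lemma hs_norm_nonneg: "0 \<le> hs_norm Q A"
  unfolding hs_norm_def by (simp add: infsum_nonneg)

text \<open>An operator on \<open>U\<^sub>0\<close> pulled back along \<open>Q\<^sup>1\<^sup>/\<^sup>2\<close> becomes a bounded operator on all of \<open>U\<close> that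
  vanishes on the kernel. Adjoints with respect to \<open>U\<^sub>0\<close> then become ordinary adjoints.\<close>

definition hs_op :: "('u::real_inner \<Rightarrow>\<^sub>L 'u) \<Rightarrow> ('u \<Rightarrow> 'a::real_inner) \<Rightarrow> 'u \<Rightarrow>\<^sub>L 'a" where
  "hs_op Q A = Blinfun (\<lambda>x. A (sqrt_op Q x))"

lemma apply_hs_op:
  fixes Q :: "'u::{real_inner,banach} \<Rightarrow>\<^sub>L 'u"
  assumes A: "hilbert_schmidt Q A"
  shows "hs_op Q A x = A (sqrt_op Q x)"
proof -
  obtain M where M: "\<And>u. u \<in> U0 Q \<Longrightarrow> norm (A u) \<le> M * sqrt (U0_inner Q u u)"
    using A unfolding hilbert_schmidt_def by blast
  have "bounded_linear (\<lambda>x. A (sqrt_op Q x))"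
  proof
    show "A (sqrt_op Q (x + y)) = A (sqrt_op Q x) + A (sqrt_op Q y)"
      "A (sqrt_op Q (r *\<^sub>R x)) = r *\<^sub>R A (sqrt_op Q x)" for x y r
      using A by (simp_all add: hilbert_schmidt_def blinfun.add_right blinfun.scaleR_right sqrt_op_in_U0)
    show "\<exists>K. \<forall>x. norm (A (sqrt_op Q x)) \<le> norm x * K"
    proof (intro exI allI)
      fix x
      have "norm (A (sqrt_op Q x)) \<le> M * norm (pseudoinverse (sqrt_op Q) (sqrt_op Q x))"
        using M[OF sqrt_op_in_U0] by (simp add: U0_inner_def norm_eq_sqrt_inner)
      also have "\<dots> \<le> \<bar>M\<bar> * norm x"
        by (intro mult_mono norm_pseudoinverse_le) auto
      finally show "norm (A (sqrt_op Q x)) \<le> norm x * \<bar>M\<bar>" by (simp add: mult.commute)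
    qed
  qed
  then show ?thesis by (simp add: hs_op_def bounded_linear_Blinfun_apply)
qed

lemma hs_op_adjoint_in_coimage:
  fixes Q :: "'u::{real_inner,banach} \<Rightarrow>\<^sub>L 'u"
  assumes "hilbert_schmidt Q A"
  shows "blinfun_adjoint (hs_op Q A) x \<in> coimage (sqrt_op Q)"
  using assms
  by (simp add: coimage_def inner_blinfun_adjoint_left apply_hs_op hilbert_schmidt_zero)

lemma U0_adjoint_eq:
  fixes Q :: "'u::{real_inner,banach} \<Rightarrow>\<^sub>L 'u"
  assumes A: "hilbert_schmidt Q A"
  shows "U0_adjoint Q A x = sqrt_op Q (blinfun_adjoint (hs_op Q A) x)"
  unfolding U0_adjoint_def
proof (rule the_equality)
  let ?w = "blinfun_adjoint (hs_op Q A) x"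
  have w: "?w \<in> coimage (sqrt_op Q)" by (rule hs_op_adjoint_in_coimage[OF A])
  have eq: "?w \<bullet> z = x \<bullet> A (sqrt_op Q z)" for z
    by (simp add: inner_blinfun_adjoint_left apply_hs_op[OF A])
  show "sqrt_op Q ?w \<in> U0 Q \<and> (\<forall>u\<in>U0 Q. U0_inner Q (sqrt_op Q ?w) u = x \<bullet> A u)"
    by (auto simp: sqrt_op_in_U0 eq U0_inner_apply[OF w] elim!: U0E)
  fix v assume v: "v \<in> U0 Q \<and> (\<forall>u\<in>U0 Q. U0_inner Q v u = x \<bullet> A u)"
  then obtain z where z: "z \<in> coimage (sqrt_op Q)" "v = sqrt_op Q z" using U0E by blast
  have d: "z - ?w \<in> coimage (sqrt_op Q)" by (rule subspace_diff[OF subspace_coimage z(1) w])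
  have "U0_inner Q v (sqrt_op Q (z - ?w)) = x \<bullet> A (sqrt_op Q (z - ?w))"
    using v sqrt_op_in_U0 by blast
  then have "z \<bullet> (z - ?w) = ?w \<bullet> (z - ?w)"
    by (simp only: z(2) eq U0_inner_apply[OF z(1) d])
  then have "(z - ?w) \<bullet> (z - ?w) = 0" by (simp add: inner_diff_left)
  then show "v = sqrt_op Q ?w" using z(2) by simp
qed

lemma hilbert_schmidt_blinfun_compose:
  assumes A: "hilbert_schmidt Q A"
  shows "hilbert_schmidt Q (\<lambda>u. blinfun_apply D (A u))"
  unfolding hilbert_schmidt_def
proof (intro conjI allI impI)
  show "\<forall>u\<in>U0 Q. \<forall>v\<in>U0 Q. D (A (u + v)) = D (A u) + D (A v)"
    "\<forall>u\<in>U0 Q. \<forall>c. D (A (c *\<^sub>R u)) = c *\<^sub>R D (A u)"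
    using A by (simp_all add: hilbert_schmidt_def blinfun.add_right blinfun.scaleR_right)
  obtain M where M: "\<And>u. u \<in> U0 Q \<Longrightarrow> norm (A u) \<le> M * sqrt (U0_inner Q u u)"
    using A unfolding hilbert_schmidt_def by blast
  show "\<exists>M. \<forall>u\<in>U0 Q. norm (D (A u)) \<le> M * sqrt (U0_inner Q u u)"
    using order_trans[OF norm_blinfun mult_left_mono[OF M norm_ge_zero], of _ D]
    by (intro exI[of _ "norm D * M"]) (simp add: mult.assoc)
  fix E assume "U0_orthonormal_basis Q E"
  then have s: "(\<lambda>e. (norm D)\<^sup>2 * (norm (A e))\<^sup>2) summable_on E"
    using A unfolding hilbert_schmidt_def by (intro summable_on_cmult_right) blast
  show "(\<lambda>e. (norm (D (A e)))\<^sup>2) summable_on E"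
    by (rule summable_on_comparison_test[OF s])
      (auto simp flip: power_mult_distrib intro!: power_mono norm_blinfun)
qed

lemma summable_product_l2:
  fixes f g :: "nat \<Rightarrow> real"
  assumes f: "(\<lambda>n. (f n)\<^sup>2) sums F\<^sup>2" and g: "(\<lambda>n. (g n)\<^sup>2) sums G\<^sup>2"
    and nn: "\<And>n. 0 \<le> f n" "\<And>n. 0 \<le> g n" "0 \<le> F" "0 \<le> G"
  shows "summable (\<lambda>n. f n * g n)" "(\<Sum>n. f n * g n) \<le> F * G"
proof -
  have l2: "L2_set h {..<N} \<le> H" if "(\<lambda>n. (h n)\<^sup>2) sums H\<^sup>2" "0 \<le> H" for h :: "nat \<Rightarrow> real" and H N
  proof -
    have "(\<Sum>n<N. (h n)\<^sup>2) \<le> H\<^sup>2"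
      using sum_le_suminf[OF sums_summable[OF that(1)], of "{..<N}"] that(1) by (simp add: sums_iff)
    then show ?thesis unfolding L2_set_def using that(2) by (simp add: real_le_lsqrt sum_nonneg)
  qed
  have bd: "(\<Sum>n<N. f n * g n) \<le> F * G" for N
  proof -
    have "(\<Sum>n<N. \<bar>f n\<bar> * \<bar>g n\<bar>) \<le> L2_set f {..<N} * L2_set g {..<N}" by (rule L2_set_mult_ineq)
    also have "\<dots> \<le> F * G" by (intro mult_mono l2 f g nn) simp
    finally show ?thesis using nn by simp
  qed
  show s: "summable (\<lambda>n. f n * g n)"
    by (rule summableI_nonneg_bounded[of _ "F * G"]) (use nn bd in auto)
  show "(\<Sum>n. f n * g n) \<le> F * G" by (rule suminf_le_const[OF s bd])
qed

text \<open>The product \<open>A B\<^sup>*\<close> on \<open>H\<close>, the adjoint being that of an operator from \<open>U\<^sub>0\<close> to \<open>H\<close>. The noise term is the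
  case \<open>A = B\<close>; its continuity is proved by expanding this product bilinearly.\<close>

definition hs_prod :: "('u::real_inner \<Rightarrow>\<^sub>L 'u) \<Rightarrow> ('u \<Rightarrow> 'a) \<Rightarrow> ('u \<Rightarrow> 'a::{real_inner,banach}) \<Rightarrow> 'a trace_class_op" where
  "hs_prod Q A B = tc_of (hs_op Q A o\<^sub>L blinfun_adjoint (hs_op Q B))"

text \<open>Expanding \<open>B\<^sup>* x\<close> in the orthonormal basis yields the nuclear representation
  \<open>A B\<^sup>* = \<Sum>e. B e \<otimes> A e\<close>, and the Cauchy-Schwarz inequality for series bounds its trace norm.\<close>

lemma
  fixes Q :: "'u::{real_inner,banach,second_countable_topology} \<Rightarrow>\<^sub>L 'u"
    and A B :: "'u \<Rightarrow> 'a::{real_inner,banach}"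
  assumes A: "hilbert_schmidt Q A" and B: "hilbert_schmidt Q B"
  shows op_of_hs_prod: "op_of (hs_prod Q A B) = hs_op Q A o\<^sub>L blinfun_adjoint (hs_op Q B)"
    and norm_hs_prod_le: "norm (hs_prod Q A B) \<le> hs_norm Q A * hs_norm Q B"
proof -
  obtain e :: "nat \<Rightarrow> 'u" where e: "\<forall>n. e n \<in> coimage (sqrt_op Q)"
    "\<forall>m n. m \<noteq> n \<longrightarrow> e m \<bullet> e n = 0"
    "\<forall>n. norm (e n) = 0 \<or> norm (e n) = 1"
    "\<forall>w\<in>coimage (sqrt_op Q). (\<forall>n. w \<bullet> e n = 0) \<longrightarrow> w = 0"
    and hs': "\<forall>A :: 'u \<Rightarrow> 'a. hilbert_schmidt Q A \<longrightarrow>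
       (\<lambda>n. (norm (A (sqrt_op Q (e n))))\<^sup>2) sums (hs_norm Q A)\<^sup>2"
    by (rule U0_basis_sequence)
  note hs = hs'[rule_format]
  let ?a = "\<lambda>n. B (sqrt_op Q (e n))" and ?b = "\<lambda>n. A (sqrt_op Q (e n))"
  note l2 = summable_product_l2[OF hs[OF B] hs[OF A] norm_ge_zero norm_ge_zero
      hs_norm_nonneg hs_norm_nonneg]
  have rep: "nuclear_rep ?a ?b (hs_op Q A o\<^sub>L blinfun_adjoint (hs_op Q B))"
    unfolding nuclear_rep_def
  proof (intro conjI allI l2(1))
    fix x
    let ?w = "blinfun_adjoint (hs_op Q B) x"
    have coeff: "?w \<bullet> e n = ?a n \<bullet> x" for n
      by (simp add: inner_blinfun_adjoint_left apply_hs_op[OF B] inner_commute[of x])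
    have "(\<lambda>n. (?w \<bullet> e n) *\<^sub>R e n) sums ?w"
      by (rule orthonormal_expansion[OF subspace_coimage closed_coimage e[rule_format] hs_op_adjoint_in_coimage[OF B]])
    from bounded_linear.sums[OF blinfun.bounded_linear_right this, of "hs_op Q A"]
    show "(\<lambda>n. (?a n \<bullet> x) *\<^sub>R ?b n) sums
        blinfun_apply (hs_op Q A o\<^sub>L blinfun_adjoint (hs_op Q B)) x"
      by (simp add: coeff blinfun.scaleR_right apply_hs_op[OF A])
  qed
  show "op_of (hs_prod Q A B) = hs_op Q A o\<^sub>L blinfun_adjoint (hs_op Q B)"
    unfolding hs_prod_def by (rule op_of_tc_of[OF nuclear_rep_imp_trace_class[OF rep]])
  show "norm (hs_prod Q A B) \<le> hs_norm Q A * hs_norm Q B"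
    unfolding hs_prod_def using norm_tc_of_le[OF rep] l2(2) by (simp add: mult.commute)
qed

lemma noise_term_eq:
  fixes Q :: "'u::{real_inner,banach} \<Rightarrow>\<^sub>L 'u"
    and S :: "real \<Rightarrow> 'k::real_inner \<Rightarrow>\<^sub>L 'h::{real_inner,banach}"
  assumes "hilbert_schmidt Q B"
  shows "noise_term Q S B r = hs_prod Q (\<lambda>u. S r (B u)) (\<lambda>u. S r (B u))"
proof -
  let ?A = "\<lambda>u. S r (B u)"
  have A: "hilbert_schmidt Q ?A" by (rule hilbert_schmidt_blinfun_compose[OF assms])
  have "(\<lambda>x. S r (B (U0_adjoint Q ?A x))) = blinfun_apply (hs_op Q ?A o\<^sub>L blinfun_adjoint (hs_op Q ?A))"
    by (simp add: fun_eq_iff U0_adjoint_eq[OF A] apply_hs_op[OF A])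
  then show ?thesis by (simp add: noise_term_def hs_prod_def blinfun_apply_inverse)
qed

lemma norm_noise_term_le:
  fixes Q :: "'u::{real_inner,banach,second_countable_topology} \<Rightarrow>\<^sub>L 'u"
    and S :: "real \<Rightarrow> 'k::real_inner \<Rightarrow>\<^sub>L 'h::{real_inner,banach}"
  assumes "hilbert_schmidt Q B"
  shows "norm (noise_term Q S B r) \<le> (hs_norm Q (\<lambda>u. S r (B u)))\<^sup>2"
  unfolding noise_term_eq[OF assms] power2_eq_square
  by (intro norm_hs_prod_le hilbert_schmidt_blinfun_compose assms)

lemma tc_adj_noise_term:
  fixes Q :: "'u::{real_inner,banach,second_countable_topology} \<Rightarrow>\<^sub>L 'u"
    and S :: "real \<Rightarrow> 'k::real_inner \<Rightarrow>\<^sub>L 'h::{real_inner,banach}"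
  assumes "hilbert_schmidt Q B"
  shows "tc_adj (noise_term Q S B r) = noise_term Q S B r"
  unfolding tc_adj_eq_iff noise_term_eq[OF assms]
    op_of_hs_prod[OF hilbert_schmidt_blinfun_compose[OF assms] hilbert_schmidt_blinfun_compose[OF assms]]
  unfolding sym_ops_def mem_Collect_eq blinfun_apply_blinfun_compose
  by (simp only: blinfun_adjoint_adjoint simp_thms flip: inner_blinfun_adjoint)

text \<open>With \<open>G\<^sub>r = S(r) B\<close> and \<open>D = G\<^sub>r - G\<^sub>t\<close> one has
  \<open>G\<^sub>r G\<^sub>r\<^sup>* - G\<^sub>t G\<^sub>t\<^sup>* = D D\<^sup>* + D G\<^sub>t\<^sup>* + G\<^sub>t D\<^sup>*\<close>. In this form only \<open>G\<^sub>t\<close> occurs besides \<open>D\<close>, so the bound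
  tends to zero with \<open>D\<close> for fixed \<open>t\<close>.\<close>

lemma norm_noise_term_diff_le:
  fixes Q :: "'u::{real_inner,banach,second_countable_topology} \<Rightarrow>\<^sub>L 'u"
    and S :: "real \<Rightarrow> 'k::real_inner \<Rightarrow>\<^sub>L 'h::{real_inner,banach}"
  assumes B: "hilbert_schmidt Q B"
  defines "d \<equiv> \<lambda>r t. hs_norm Q (\<lambda>u. S r (B u) - S t (B u))"
  shows "norm (noise_term Q S B r - noise_term Q S B t)
    \<le> (d r t)\<^sup>2 + 2 * d r t * hs_norm Q (\<lambda>u. S t (B u))"
proof -
  define D where "D = (\<lambda>u. S r (B u) - S t (B u))"
  let ?G = "\<lambda>u. S t (B u)" and ?G' = "\<lambda>u. S r (B u)"
  have G: "hilbert_schmidt Q ?G" "hilbert_schmidt Q ?G'"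
    by (rule hilbert_schmidt_blinfun_compose[OF B])+
  have D: "hilbert_schmidt Q D"
    using hilbert_schmidt_blinfun_compose[OF B, of "S r - S t"] by (simp add: D_def blinfun.diff_left)
  have "hs_op Q ?G' = hs_op Q D + hs_op Q ?G"
    by (rule blinfun_eqI) (simp add: apply_hs_op G D blinfun.add_left, simp add: D_def)
  moreover have "blinfun_adjoint (hs_op Q D + hs_op Q ?G)
      = blinfun_adjoint (hs_op Q D) + blinfun_adjoint (hs_op Q ?G)"
    by (rule blinfun_adjoint_eqI) (simp add: blinfun.add_left inner_add_left inner_add_right inner_blinfun_adjoint)
  ultimately have eq: "noise_term Q S B r - noise_term Q S B t
      = hs_prod Q D D + hs_prod Q D ?G + hs_prod Q ?G D"
    unfolding noise_term_eq[OF B]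
    by (intro trace_class_op_eqI)
      (simp add: op_of_simps op_of_hs_prod G D blinfun.add_left blinfun.diff_left blinfun.add_right)
  have dD: "d r t = hs_norm Q D" by (simp add: d_def D_def)
  have "norm (noise_term Q S B r - noise_term Q S B t) \<le> norm (hs_prod Q D D) + norm (hs_prod Q D ?G) + norm (hs_prod Q ?G D)"
    unfolding eq by (intro norm_triangle_mono order_refl norm_triangle_ineq)
  also have "\<dots> \<le> d r t * d r t + d r t * hs_norm Q ?G + hs_norm Q ?G * d r t"
    using norm_hs_prod_le[OF D D] norm_hs_prod_le[OF D G(1)] norm_hs_prod_le[OF G(1) D]
    unfolding dD by linarith
  finally show ?thesis by (simp add: power2_eq_square algebra_simps)
qed

section \<open>Linear Volterra equations of convolution type\<close>

text \<open>For simple \<open>f\<close> the composition is pieced together from finitely many of the functions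
  \<open>\<lambda>r. L r x\<close>; the general case is a pointwise limit, by continuity in the second argument.\<close>

lemma measurable_Caratheodory:
  fixes L :: "'m \<Rightarrow> 'e::{metric_space,second_countable_topology} \<Rightarrow> 'f::metric_space"
  assumes L: "\<And>x. (\<lambda>r. L r x) \<in> borel_measurable M"
    and cont: "\<And>r. continuous_on UNIV (L r)"
    and f: "f \<in> borel_measurable M"
  shows "(\<lambda>r. L r (f r)) \<in> borel_measurable M"
proof -
  obtain F where F: "\<And>i. simple_function M (F i)" "\<And>r. r \<in> space M \<Longrightarrow> (\<lambda>i. F i r) \<longlonglongrightarrow> f r"
    using borel_measurable_implies_sequence_metric[OF f] by metis
  show ?thesis
  proof (rule borel_measurable_LIMSEQ_metric)
    show "(\<lambda>r. L r (F i r)) \<in> borel_measurable M" for i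
      by (rule measurable_compose_countable'[of "F i ` space M" "\<lambda>x r. L r x", OF L])
        (use F(1)[of i] in \<open>auto simp: simple_function_def intro: countable_finite
            simple_function_measurable2 measurable_count_space_eq2[THEN iffD2]\<close>)
    show "(\<lambda>i. L r (F i r)) \<longlonglongrightarrow> L r (f r)" if "r \<in> space M" for r
      using continuous_on_tendsto_compose[OF cont[of r] F(2)[OF that]] by simp
  qed
qed

text \<open>The integrand including the indicator is continuous in \<open>t\<close> except at \<open>t = r\<close>, a null set of \<open>r\<close>
  for each \<open>t\<close>, so dominated convergence applies.\<close>

lemma continuous_truncated_integral:
  fixes h :: "real \<Rightarrow> real \<Rightarrow> 'e::{banach,second_countable_topology}"
  assumes meas: "\<And>t. h t \<in> borel_measurable lebesgue"
    and le: "\<And>t r. norm (h t r) \<le> w r" and w: "integrable lebesgue w"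
    and cont: "\<And>r. continuous_on UNIV (\<lambda>t. h t r)"
  shows "continuous_on UNIV (\<lambda>t. LINT r:{0<..<t}|lebesgue. h t r)"
proof (intro continuous_at_imp_continuous_on ballI)
  fix t :: real
  have w0: "0 \<le> w r" for r using le[of 0 r] norm_ge_zero order_trans by blast
  have "(\<lambda>n. LINT r:{0<..<x n}|lebesgue. h (x n) r) \<longlonglongrightarrow> (LINT r:{0<..<t}|lebesgue. h t r)"
    if x: "x \<longlonglongrightarrow> t" for x
    unfolding set_lebesgue_integral_def
  proof (rule integral_dominated_convergence[where w = w])
    have [measurable]: "{0<..<s} \<in> sets lebesgue" for s :: real by simp
    show "(\<lambda>r. indicator {0<..<t} r *\<^sub>R h t r) \<in> borel_measurable lebesgue"
      "(\<lambda>r. indicator {0<..<x n} r *\<^sub>R h (x n) r) \<in> borel_measurable lebesgue" for n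
      using meas by measurable
    show "AE r in lebesgue. norm (indicator {0<..<x n} r *\<^sub>R h (x n) r) \<le> w r" for n
      using le w0 by (intro AE_I2) (auto simp: indicator_def)
    have "AE r in lebesgue. r \<noteq> t" by (rule AE_completion[OF AE_lborel_singleton])
    then show "AE r in lebesgue. (\<lambda>n. indicator {0<..<x n} r *\<^sub>R h (x n) r)
        \<longlonglongrightarrow> indicator {0<..<t} r *\<^sub>R h t r"
    proof (rule eventually_mono)
      fix r assume "r \<noteq> t"
      have ind: "eventually (\<lambda>n. indicator {0<..<x n} r = (indicator {0<..<t} r :: real)) sequentially"
      proof (cases "r < t")
        case True
        from order_tendstoD(1)[OF x this] show ?thesis
          by eventually_elim (use True in \<open>auto simp: indicator_def\<close>)
      next
        case False
        with \<open>r \<noteq> t\<close> have "t < r" by simp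
        from order_tendstoD(2)[OF x this] show ?thesis
          by eventually_elim (use False in \<open>auto simp: indicator_def\<close>)
      qed
      have "(\<lambda>n. h (x n) r) \<longlonglongrightarrow> h t r"
        using continuous_on_tendsto_compose[OF cont x] by simp
      then have "(\<lambda>n. indicator {0<..<t} r *\<^sub>R h (x n) r) \<longlonglongrightarrow> indicator {0<..<t} r *\<^sub>R h t r"
        by (intro tendsto_intros)
      then show "(\<lambda>n. indicator {0<..<x n} r *\<^sub>R h (x n) r) \<longlonglongrightarrow> indicator {0<..<t} r *\<^sub>R h t r"
        by (rule Lim_transform_eventually) (use ind in eventually_elim, simp)
    qed
  qed (rule w)
  then show "isCont (\<lambda>t. LINT r:{0<..<t}|lebesgue. h t r) t"
    unfolding continuous_at_sequentially by (simp add: o_def)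
qed

text \<open>A kernel on the positive half line, extended by zero: this makes the integral of \<open>k\<close> over the
  whole line the relevant size, and lets \<open>exp (- \<mu> r) k r\<close> decrease as \<open>\<mu>\<close> grows.\<close>

locale volterra_kernel =
  fixes L :: "real \<Rightarrow> 'e::{banach,second_countable_topology} \<Rightarrow>\<^sub>L 'e" and k :: "real \<Rightarrow> real"
  assumes meas: "\<And>x. (\<lambda>r. L r x) \<in> borel_measurable lebesgue"
    and norm_le: "\<And>r. norm (L r) \<le> k r"
    and k_int: "integrable lebesgue k"
    and k_zero: "\<And>r. r \<le> 0 \<Longrightarrow> k r = 0"
begin

definition conv :: "(real \<Rightarrow> 'e) \<Rightarrow> real \<Rightarrow> 'e" where
  "conv f t = (LINT r:{0<..<t}|lebesgue. L r (f (t - r)))"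

lemma k_nonneg: "0 \<le> k r"
  using norm_le[of r] norm_ge_zero order_trans by blast

lemma conv_cong: "(\<And>s. 0 < s \<Longrightarrow> s < t \<Longrightarrow> f s = g s) \<Longrightarrow> conv f t = conv g t"
  unfolding conv_def set_lebesgue_integral_def
  by (intro Bochner_Integration.integral_cong) (auto simp: indicator_def)

lemma apply_le: "norm (L r x) \<le> k r * norm x"
  by (rule order_trans[OF norm_blinfun mult_right_mono[OF norm_le norm_ge_zero]])

lemma apply_le_bound: "norm x \<le> B \<Longrightarrow> norm (L r x) \<le> k r * B"
  by (rule order_trans[OF apply_le mult_left_mono[OF _ k_nonneg]])

lemma shift_measurable:
  assumes "continuous_on UNIV f"
  shows "(\<lambda>r. L r (f (t - r))) \<in> borel_measurable lebesgue"
proof (rule measurable_Caratheodory[OF meas])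
  show "continuous_on UNIV (blinfun_apply (L r))" for r by (intro continuous_intros)
  have "continuous_on UNIV (\<lambda>r. f (t - r))"
    by (intro continuous_on_compose2[OF assms] continuous_intros) simp
  then show "(\<lambda>r. f (t - r)) \<in> borel_measurable lebesgue"
    by (intro measurable_completion) (simp add: borel_measurable_continuous_onI)
qed

lemma conv_integrable:
  assumes "continuous_on UNIV f" "\<And>x. norm (f x) \<le> B"
  shows "set_integrable lebesgue {0<..<t} (\<lambda>r. L r (f (t - r)))"
  unfolding set_integrable_def
proof (rule Bochner_Integration.integrable_bound[of _ "\<lambda>r. k r * B"])
  show "integrable lebesgue (\<lambda>r. k r * B)" using k_int by simp
  have [measurable]: "{0<..<t} \<in> sets lebesgue" by simp
  show "(\<lambda>r. indicator {0<..<t} r *\<^sub>R L r (f (t - r))) \<in> borel_measurable lebesgue"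
    using shift_measurable[OF assms(1)] by measurable
  have "0 \<le> B" using assms(2) norm_ge_zero order_trans by blast
  then show "AE r in lebesgue. norm (indicator {0<..<t} r *\<^sub>R L r (f (t - r))) \<le> norm (k r * B)"
    using apply_le_bound[OF assms(2)] k_nonneg by (intro AE_I2) (auto simp: indicator_def)
qed

lemma norm_conv_le:
  assumes "continuous_on UNIV f" "\<And>x. norm (f x) \<le> B"
  shows "norm (conv f t) \<le> (LINT r|lebesgue. k r) * B"
proof -
  have "0 \<le> B" using assms(2) norm_ge_zero order_trans by blast
  have "norm (conv f t) \<le> (LINT r|lebesgue. k r * B)"
    unfolding conv_def set_lebesgue_integral_def
    by (rule Bochner_Integration.integral_norm_bound_integral[OF
          conv_integrable[OF assms, unfolded set_integrable_def]])
      (use k_int apply_le_bound[OF assms(2)] k_nonneg \<open>0 \<le> B\<close> in \<open>auto simp: indicator_def\<close>)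
  then show ?thesis by simp
qed

lemma continuous_conv:
  assumes "continuous_on UNIV f" "\<And>x. norm (f x) \<le> B"
  shows "continuous_on UNIV (conv f)"
  unfolding conv_def
  by (rule continuous_truncated_integral[of "\<lambda>t r. L r (f (t - r))" "\<lambda>r. k r * B"])
    (use k_int in \<open>auto intro!: shift_measurable assms apply_le_bound continuous_intros
        continuous_on_compose2[OF assms(1)]\<close>)

lemma conv_diff:
  assumes "continuous_on UNIV f" "\<And>x. norm (f x) \<le> B"
    and "continuous_on UNIV g" "\<And>x. norm (g x) \<le> B'"
  shows "conv (\<lambda>s. f s - g s) t = conv f t - conv g t"
  using set_integral_diff(2)[OF conv_integrable[OF assms(1,2)] conv_integrable[OF assms(3,4)]]
  by (simp add: conv_def blinfun.diff_right)

text \<open>The map sending \<open>f\<close> to \<open>g + conv f\<close> is a contraction with constant \<open>1/2\<close> of the space of bounded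
  continuous functions on the whole line.\<close>

lemma small_kernel_solution:
  assumes small: "(LINT r|lebesgue. k r) \<le> 1/2"
    and g: "continuous_on UNIV g" "\<And>x. norm (g x) \<le> G"
  shows "\<exists>f. continuous_on UNIV f \<and> (\<forall>t. f t = g t + conv f t)"
proof -
  define \<Phi> where "\<Phi> f = Bcontfun (\<lambda>t. g t + conv (apply_bcontfun f) t)" for f
  have bnd: "norm (apply_bcontfun f x) \<le> norm f" for f :: "real \<Rightarrow>\<^sub>C 'e" and x
    by (rule norm_bounded)
  have \<Phi>: "apply_bcontfun (\<Phi> f) t = g t + conv (apply_bcontfun f) t" for f t
  proof -
    have "(\<lambda>t. g t + conv (apply_bcontfun f) t) \<in> bcontfun"
    proof (rule bcontfun_normI)
      show "continuous_on UNIV (\<lambda>t. g t + conv (apply_bcontfun f) t)"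
        by (rule continuous_on_add[OF g(1) continuous_conv[OF continuous_on_apply_bcontfun bnd]])
      show "norm (g t + conv (apply_bcontfun f) t) \<le> G + (LINT r|lebesgue. k r) * norm f" for t
        by (intro norm_triangle_mono g norm_conv_le bnd) simp
    qed
    then show ?thesis by (simp add: \<Phi>_def Bcontfun_inverse)
  qed
  have "dist (\<Phi> f) (\<Phi> h) \<le> 1/2 * dist f h" for f h
  proof (rule dist_bound)
    fix t
    have "dist (\<Phi> f t) (\<Phi> h t) = norm (conv (\<lambda>s. f s - h s) t)"
      by (subst conv_diff[OF _ bnd _ bnd]) (simp_all add: dist_norm \<Phi>)
    also have "\<dots> \<le> (LINT r|lebesgue. k r) * dist f h"
      using dist_bounded[of f _ h] by (intro norm_conv_le continuous_intros) (simp_all add: dist_norm)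
    also have "\<dots> \<le> 1/2 * dist f h" by (rule mult_right_mono[OF small zero_le_dist])
    finally show "dist (\<Phi> f t) (\<Phi> h t) \<le> 1/2 * dist f h" .
  qed
  then obtain f where "\<Phi> f = f" using banach_fix_type[of "1/2" \<Phi>] by auto
  then have "f t = g t + conv f t" for t using \<Phi>[of f t] by simp
  then show ?thesis
    by (intro exI[of _ "apply_bcontfun f"] conjI allI continuous_on_apply_bcontfun)
qed

text \<open>Extending by the values at the end points reduces functions on \<open>{0..T}\<close> to bounded continuous
  functions on the whole line.\<close>

lemma clamped:
  fixes f :: "real \<Rightarrow> 'e"
  assumes "0 \<le> T" and f: "continuous_on {0..T} f"
  obtains f' B where "continuous_on UNIV f'" "\<And>x. norm (f' x) \<le> B"
    "\<And>t. t \<in> {0..T} \<Longrightarrow> f' t = f t"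
proof -
  obtain B where B: "\<And>t. t \<in> {0..T} \<Longrightarrow> norm (f t) \<le> B"
    using compact_imp_bounded[OF compact_continuous_image[OF f compact_Icc]]
    unfolding bounded_iff by (meson imageI)
  show ?thesis
  proof (rule that[of "\<lambda>t. f (max 0 (min T t))" B])
    show "continuous_on UNIV (\<lambda>t. f (max 0 (min T t)))"
      by (rule continuous_on_compose2[OF f]) (use assms in \<open>auto intro!: continuous_intros\<close>)
  qed (use assms in \<open>auto intro!: B\<close>)
qed

lemma set_integrable_conv:
  assumes T: "0 \<le> T" and f: "continuous_on {0..T} f" and t: "t \<in> {0..T}"
  shows "set_integrable lebesgue {0<..<t} (\<lambda>r. L r (f (t - r)))"
proof -
  obtain f' B where f': "continuous_on UNIV f'" "\<And>x. norm (f' x) \<le> B"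
      "\<And>t. t \<in> {0..T} \<Longrightarrow> f' t = f t"
    using clamped[OF T f] by metis
  have "(\<lambda>r. indicator {0<..<t} r *\<^sub>R L r (f' (t - r))) = (\<lambda>r. indicator {0<..<t} r *\<^sub>R L r (f (t - r)))"
    using t f'(3) by (auto simp: fun_eq_iff indicator_def)
  then show ?thesis
    using conv_integrable[OF f'(1,2), of t] by (simp add: set_integrable_def)
qed

text \<open>At a point \<open>s\<close> where \<open>norm (D s)\<close> is maximal, the equation gives
  \<open>norm (D s) \<le> 1/2 * norm (D s)\<close>.\<close>

lemma small_kernel_unique:
  assumes small: "(LINT r|lebesgue. k r) \<le> 1/2" and T: "0 \<le> T"
    and D: "continuous_on {0..T} D" "\<And>t. t \<in> {0..T} \<Longrightarrow> D t = conv D t"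
    and t: "t \<in> {0..T}"
  shows "D t = 0"
proof -
  have "\<exists>s\<in>{0..T}. \<forall>t\<in>{0..T}. norm (D t) \<le> norm (D s)"
    by (rule continuous_attains_sup) (use T D(1) in \<open>auto intro!: continuous_intros\<close>)
  then obtain s where s: "s \<in> {0..T}" "\<And>t. t \<in> {0..T} \<Longrightarrow> norm (D t) \<le> norm (D s)" by blast
  define f where "f t = D (max 0 (min T t))" for t
  have f: "continuous_on UNIV f"
    unfolding f_def by (rule continuous_on_compose2[OF D(1)]) (use T in \<open>auto intro!: continuous_intros\<close>)
  have le: "norm (f x) \<le> norm (D s)" for x unfolding f_def using T by (intro s(2)) auto
  have "D s = conv f s"
    unfolding D(2)[OF s(1)] by (rule conv_cong) (use s in \<open>simp add: f_def\<close>)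
  then have "norm (D s) \<le> (LINT r|lebesgue. k r) * norm (D s)"
    using norm_conv_le[OF f le, of s] by simp
  also have "\<dots> \<le> 1/2 * norm (D s)" by (rule mult_right_mono[OF small norm_ge_zero])
  finally have "norm (D s) = 0" using norm_ge_zero[of "D s"] by linarith
  then show ?thesis using s(2)[OF t] by simp
qed

text \<open>As \<open>\<mu> \<rightarrow> \<infinity>\<close> the weighted kernel tends to zero pointwise and is dominated by \<open>k\<close>, so its integral
  becomes small.\<close>

lemma exp_weight:
  obtains \<mu> where "volterra_kernel (\<lambda>r. exp (- \<mu> * r) *\<^sub>R L r) (\<lambda>r. exp (- \<mu> * r) * k r)"
    "(LINT r|lebesgue. exp (- \<mu> * r) * k r) \<le> 1/2"
proof -
  have le: "exp (- \<mu> * r) * k r \<le> k r" if "0 \<le> \<mu>" for \<mu> r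
    using k_zero[of r] k_nonneg[of r] that by (cases "r \<le> 0") (auto intro!: mult_left_le_one_le)
  have [measurable]: "k \<in> borel_measurable lebesgue" using k_int by auto
  have [measurable]: "(\<lambda>r. exp (- \<mu> * r)) \<in> borel_measurable lebesgue" for \<mu> :: real
    by (intro measurable_completion) simp
  have "(\<lambda>n. LINT r|lebesgue. exp (- real n * r) * k r) \<longlonglongrightarrow> integral\<^sup>L lebesgue (\<lambda>r::real. 0 :: real)"
  proof (rule integral_dominated_convergence[where w = k])
    show "AE r in lebesgue. (\<lambda>n. exp (- real n * r) * k r) \<longlonglongrightarrow> 0"
    proof (rule AE_I2)
      fix r :: real
      show "(\<lambda>n. exp (- real n * r) * k r) \<longlonglongrightarrow> 0"
      proof (cases "r \<le> 0")
        case False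
        have "exp (- real n * r) = exp (- r) ^ n" for n
          using exp_of_nat_mult[of n "- r"] by simp
        then have "(\<lambda>n. exp (- real n * r)) \<longlonglongrightarrow> 0"
          using False by (simp only:) (rule LIMSEQ_power_zero, simp)
        then show ?thesis by (rule tendsto_mult_left_zero)
      qed (simp add: k_zero)
    qed
    show "(\<lambda>r. exp (- real n * r) * k r) \<in> borel_measurable lebesgue" for n
      by measurable
    show "AE r in lebesgue. norm (exp (- real n * r) * k r) \<le> k r" for n
      using le k_nonneg by (intro AE_I2) (simp add: abs_mult)
  qed (use k_int in auto)
  then have "eventually (\<lambda>n. (LINT r|lebesgue. exp (- real n * r) * k r) < 1/2) sequentially"
    by (intro order_tendstoD(2)[of _ 0]) simp_all
  then obtain n where n: "(LINT r|lebesgue. exp (- real n * r) * k r) < 1/2"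
    by (auto simp: eventually_sequentially)
  show ?thesis
  proof (rule that[of "real n"])
    show "volterra_kernel (\<lambda>r. exp (- real n * r) *\<^sub>R L r) (\<lambda>r. exp (- real n * r) * k r)"
    proof
      show "(\<lambda>r. (exp (- real n * r) *\<^sub>R L r) x) \<in> borel_measurable lebesgue" for x
        unfolding blinfun.scaleR_left using meas[of x] by measurable
      show "norm (exp (- real n * r) *\<^sub>R L r) \<le> exp (- real n * r) * k r" for r
        using norm_le[of r] by simp
      show "integrable lebesgue (\<lambda>r. exp (- real n * r) * k r)"
      proof (rule Bochner_Integration.integrable_bound[OF k_int])
        show "(\<lambda>r. exp (- real n * r) * k r) \<in> borel_measurable lebesgue" by measurable
        show "AE r in lebesgue. norm (exp (- real n * r) * k r) \<le> norm (k r)"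
          using le k_nonneg by (intro AE_I2) (simp add: abs_mult)
      qed
    qed (simp add: k_zero)
  qed (use n in simp)
qed

text \<open>The weight factors through the convolution because \<open>exp (- \<mu> r) exp (- \<mu> (t - r)) = exp (- \<mu> t)\<close>.\<close>

lemma conv_weighted:
  assumes "volterra_kernel (\<lambda>r. exp (- \<mu> * r) *\<^sub>R L r) k'"
  shows "volterra_kernel.conv (\<lambda>r. exp (- \<mu> * r) *\<^sub>R L r) (\<lambda>s. exp (- \<mu> * s) *\<^sub>R f s) t
    = exp (- \<mu> * t) *\<^sub>R conv f t"
proof -
  have e: "exp (- (\<mu> * r)) * exp (- (\<mu> * (t - r))) = exp (- (\<mu> * t))" for r
    by (simp flip: exp_add add: algebra_simps)
  then have e': "exp (- (\<mu> * (t - r))) * exp (- (\<mu> * r)) = exp (- (\<mu> * t))" for r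
    by (subst mult.commute)
  have "volterra_kernel.conv (\<lambda>r. exp (- \<mu> * r) *\<^sub>R L r) (\<lambda>s. exp (- \<mu> * s) *\<^sub>R f s) t
      = (LINT r:{0<..<t}|lebesgue. exp (- \<mu> * t) *\<^sub>R L r (f (t - r)))"
    unfolding volterra_kernel.conv_def[OF assms]
    by (simp add: blinfun.scaleR_left blinfun.scaleR_right e e')
  then show ?thesis by (simp add: conv_def)
qed

lemma solution_exists:
  assumes T: "0 \<le> T" and g: "continuous_on {0..T} g"
  shows "\<exists>f. continuous_on {0..T} f \<and> (\<forall>t\<in>{0..T}. f t = g t + conv f t)"
proof -
  obtain \<mu> where V: "volterra_kernel (\<lambda>r. exp (- \<mu> * r) *\<^sub>R L r) (\<lambda>r. exp (- \<mu> * r) * k r)"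
    and small: "(LINT r|lebesgue. exp (- \<mu> * r) * k r) \<le> 1/2"
    by (rule exp_weight)
  have "continuous_on {0..T} (\<lambda>t. exp (- \<mu> * t) *\<^sub>R g t)" by (intro continuous_intros g)
  then obtain g' G where g': "continuous_on UNIV g'" "\<And>x. norm (g' x) \<le> G"
      "\<And>t. t \<in> {0..T} \<Longrightarrow> g' t = exp (- \<mu> * t) *\<^sub>R g t"
    using clamped[OF T] by blast
  obtain m where m: "continuous_on UNIV m"
    and m_eq: "\<And>t. m t = g' t + volterra_kernel.conv (\<lambda>r. exp (- \<mu> * r) *\<^sub>R L r) m t"
    using volterra_kernel.small_kernel_solution[OF V small g'(1,2)] by blast
  \<comment> \<open>Undoing the weight turns the fixed point of the weighted equation into a solution of the original one.\<close>
  define f where "f t = exp (\<mu> * t) *\<^sub>R m t" for t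
  have mf: "m = (\<lambda>t. exp (- \<mu> * t) *\<^sub>R f t)" by (simp add: f_def fun_eq_iff flip: exp_add)
  have "f t = g t + conv f t" if t: "t \<in> {0..T}" for t
  proof -
    have "m t = exp (- \<mu> * t) *\<^sub>R (g t + conv f t)"
      using m_eq[of t] unfolding mf conv_weighted[OF V] g'(3)[OF t] by (simp add: scaleR_add_right)
    then show ?thesis by (simp add: f_def flip: exp_add)
  qed
  moreover have "continuous_on {0..T} f"
    unfolding f_def by (intro continuous_intros continuous_on_subset[OF m]) simp
  ultimately show ?thesis by blast
qed

lemma solution_unique:
  assumes T: "0 \<le> T"
    and f: "continuous_on {0..T} f" "\<And>t. t \<in> {0..T} \<Longrightarrow> f t = g t + conv f t"
    and h: "continuous_on {0..T} h" "\<And>t. t \<in> {0..T} \<Longrightarrow> h t = g t + conv h t"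
    and t: "t \<in> {0..T}"
  shows "f t = h t"
proof -
  obtain \<mu> where V: "volterra_kernel (\<lambda>r. exp (- \<mu> * r) *\<^sub>R L r) (\<lambda>r. exp (- \<mu> * r) * k r)"
    and small: "(LINT r|lebesgue. exp (- \<mu> * r) * k r) \<le> 1/2"
    by (rule exp_weight)
  define D where "D t = exp (- \<mu> * t) *\<^sub>R (f t - h t)" for t
  have "D s = volterra_kernel.conv (\<lambda>r. exp (- \<mu> * r) *\<^sub>R L r) D s" if s: "s \<in> {0..T}" for s
  proof -
    have "conv (\<lambda>s. f s - h s) s = conv f s - conv h s"
      using set_integral_diff(2)[OF set_integrable_conv[OF T f(1) s] set_integrable_conv[OF T h(1) s]]
      by (simp add: conv_def blinfun.diff_right)
    then have "f s - h s = conv (\<lambda>s. f s - h s) s" using f(2)[OF s] h(2)[OF s] by simp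
    then show ?thesis unfolding D_def conv_weighted[OF V] by (rule arg_cong)
  qed
  moreover have "continuous_on {0..T} D" unfolding D_def by (intro continuous_intros f h)
  ultimately have "D t = 0"
    by (intro volterra_kernel.small_kernel_unique[OF V small T _ _ t])
  then show ?thesis by (simp add: D_def)
qed

end

section \<open>The Lyapunov equation as a Volterra equation\<close>

lemma lebesgue_reflect_measurable: "(\<lambda>s. t - s :: real) \<in> lebesgue \<rightarrow>\<^sub>M lebesgue"
  using lebesgue_affine_measurable[of "\<lambda>_::real. -1" t] by simp

lemma distr_lebesgue_reflect: "distr lebesgue lebesgue (\<lambda>s. t - s :: real) = lebesgue"
  using lebesgue_real_affine[of "-1" t] by (simp add: density_1)

lemma
  fixes h :: "real \<Rightarrow> 'e::{banach,second_countable_topology}"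
  shows integrable_lebesgue_reflect: "integrable lebesgue (\<lambda>s. h (t - s)) \<longleftrightarrow> integrable lebesgue h"
    and integral_lebesgue_reflect: "(LINT s|lebesgue. h (t - s)) = (LINT s|lebesgue. h s)"
proof -
  have *: "integrable lebesgue (\<lambda>s. f (t - s))" if "integrable lebesgue f" for f :: "real \<Rightarrow> 'e"
    using integrable_distr[OF lebesgue_reflect_measurable, of t f] that
    by (simp add: distr_lebesgue_reflect)
  from *[of h] *[of "\<lambda>s. h (t - s)"]
  show iff: "integrable lebesgue (\<lambda>s. h (t - s)) \<longleftrightarrow> integrable lebesgue h" by auto
  show "(LINT s|lebesgue. h (t - s)) = (LINT s|lebesgue. h s)"
  proof (cases "integrable lebesgue h")
    case True
    then show ?thesis
      using integral_distr[OF lebesgue_reflect_measurable[of t], of h]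
      by (simp add: distr_lebesgue_reflect)
  next
    case False
    with iff show ?thesis by (simp add: not_integrable_integral_eq)
  qed
qed

lemma
  fixes h :: "real \<Rightarrow> 'e::{banach,second_countable_topology}"
  shows set_integrable_reflect:
      "set_integrable lebesgue {0<..<t} (\<lambda>s. h (t - s)) \<longleftrightarrow> set_integrable lebesgue {0<..<t} h"
    and set_integral_reflect:
      "(LINT s:{0<..<t}|lebesgue. h (t - s)) = (LINT s:{0<..<t}|lebesgue. h s)"
proof -
  have "(\<lambda>s. indicator {0<..<t} s *\<^sub>R h (t - s)) = (\<lambda>s. indicator {0<..<t} (t - s) *\<^sub>R h (t - s))"
    by (auto simp: fun_eq_iff indicator_def)
  then show "set_integrable lebesgue {0<..<t} (\<lambda>s. h (t - s)) \<longleftrightarrow> set_integrable lebesgue {0<..<t} h"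
    "(LINT s:{0<..<t}|lebesgue. h (t - s)) = (LINT s:{0<..<t}|lebesgue. h s)"
    unfolding set_integrable_def set_lebesgue_integral_def
    using integrable_lebesgue_reflect[of "\<lambda>s. indicator {0<..<t} s *\<^sub>R h s" t]
      integral_lebesgue_reflect[of "\<lambda>s. indicator {0<..<t} s *\<^sub>R h s" t] by simp_all
qed

lemma set_integral_bounded_linear:
  fixes f :: "'m \<Rightarrow> 'e::{banach,second_countable_topology}" and J :: "'e \<Rightarrow> 'f::{banach,second_countable_topology}"
  assumes J: "bounded_linear J" and f: "set_integrable M A f"
  shows "J (LINT x:A|M. f x) = (LINT x:A|M. J (f x))"
  using integral_bounded_linear[OF J, of M "\<lambda>x. indicator A x *\<^sub>R f x"] f
  by (simp add: set_integrable_def set_lebesgue_integral_def linear_simps[OF J])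

locale lyapunov_equation =
  fixes \<iota> :: "'h::{real_inner,banach,second_countable_topology} \<Rightarrow>\<^sub>L 'k::real_inner"
    and Q :: "'u::{real_inner,banach,second_countable_topology} \<Rightarrow>\<^sub>L 'u"
    and S\<^sub>0 :: "'h \<Rightarrow>\<^sub>L 'h" and S :: "real \<Rightarrow> 'k \<Rightarrow>\<^sub>L 'h"
    and F :: "'h \<Rightarrow>\<^sub>L 'k" and B :: "'u \<Rightarrow> 'k" and Q\<^sub>\<xi> :: "'h trace_class_op"
    and a b :: "real \<Rightarrow> real" and C T :: real
  assumes T: "0 \<le> T"
    and B: "hilbert_schmidt Q B"
    and Q\<^sub>\<xi>: "op_of Q\<^sub>\<xi> \<in> sym_ops"
    and S_cont: "\<And>v. continuous_on {0..T} (\<lambda>t. on_H \<iota> S\<^sub>0 S t v)"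
    and SF_cont: "\<And>v. continuous_on {0<..T} (\<lambda>t. S t (F v))"
    and SB_cont: "\<And>t. t \<in> {0<..T} \<Longrightarrow>
      ((\<lambda>r. hs_norm Q (\<lambda>u. S r (B u) - S t (B u))) \<longlongrightarrow> 0) (at t within {0<..T})"
    and a_int: "set_integrable lebesgue {0..T} a"
    and b_int: "set_integrable lebesgue {0..T} (\<lambda>t. (b t)\<^sup>2)"
    and S_le: "\<And>t. t \<in> {0..T} \<Longrightarrow> norm (on_H \<iota> S\<^sub>0 S t) \<le> C"
    and SF_le: "\<And>t. t \<in> {0<..T} \<Longrightarrow> norm (S t o\<^sub>L F) \<le> a t"
    and SB_le: "\<And>t. t \<in> {0<..T} \<Longrightarrow> hs_norm Q (\<lambda>u. S t (B u)) \<le> b t"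
begin

text \<open>The families are set to zero outside \<open>{0<..T}\<close>, where continuity and the bounds are available, so
  that they define a Volterra kernel on the whole line.\<close>

definition SF :: "real \<Rightarrow> 'h \<Rightarrow>\<^sub>L 'h" where
  "SF r = (if r \<in> {0<..T} then S r o\<^sub>L F else 0)"

definition SH :: "real \<Rightarrow> 'h \<Rightarrow>\<^sub>L 'h" where
  "SH r = (if r \<in> {0<..T} then on_H \<iota> S\<^sub>0 S r else 0)"

definition kernel :: "real \<Rightarrow> 'h trace_class_op \<Rightarrow>\<^sub>L 'h trace_class_op" where
  "kernel r = Blinfun (\<lambda>X. sandwich (SF r) (SH r) X + sandwich (SH r) (SF r) X)"

definition kernel_bound :: "real \<Rightarrow> real" where
  "kernel_bound r = indicator {0<..T} r * (2 * C * a r)"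

lemma kernel_apply: "kernel r X = sandwich (SF r) (SH r) X + sandwich (SH r) (SF r) X"
  unfolding kernel_def
  by (subst bounded_linear_Blinfun_apply) (intro bounded_linear_add bounded_linear_sandwich refl)+

lemma kernel_eq_drift_term: "r \<in> {0<..T} \<Longrightarrow> kernel r X = drift_term \<iota> S\<^sub>0 S F r X"
  by (simp add: kernel_apply SF_def SH_def drift_term_def sandwich_def)

text \<open>The two summands of the drift are exchanged by taking adjoints.\<close>

lemma tc_adj_kernel: "tc_adj (kernel r X) = kernel r (tc_adj X)"
  by (simp add: kernel_apply bounded_linear.linear linear_add[OF bounded_linear.linear[OF bounded_linear_tc_adj]]
      tc_adj_sandwich add.commute)

lemma measurable_zero_extension:
  fixes f :: "real \<Rightarrow> 'e::real_normed_vector"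
  assumes "continuous_on {0<..T} f"
  shows "(\<lambda>r. if r \<in> {0<..T} then f r else 0) \<in> borel_measurable lebesgue"
proof -
  have "(\<lambda>r. indicator {0<..T} r *\<^sub>R f r) \<in> borel_measurable borel"
    by (rule borel_measurable_continuous_on_indicator[OF _ assms]) simp
  moreover have "(\<lambda>r. indicator {0<..T} r *\<^sub>R f r) = (\<lambda>r. if r \<in> {0<..T} then f r else 0)"
    by (auto simp: fun_eq_iff)
  ultimately show ?thesis by (intro measurable_completion) simp
qed

sublocale volterra_kernel kernel kernel_bound
proof
  have SF_meas: "(\<lambda>r. SF r v) \<in> borel_measurable lebesgue" for v
    using measurable_zero_extension[OF SF_cont[of v]]
    by (rule measurable_cong[THEN iffD1, rotated]) (simp add: SF_def)
  have SH_meas: "(\<lambda>r. SH r v) \<in> borel_measurable lebesgue" for v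
    using measurable_zero_extension[OF continuous_on_subset[OF S_cont[of v]]]
    by (rule measurable_cong[THEN iffD1, rotated]) (auto simp: SH_def)
  show "(\<lambda>r. kernel r X) \<in> borel_measurable lebesgue" for X
    unfolding kernel_apply by (intro borel_measurable_add measurable_sandwich SF_meas SH_meas)
  show "norm (kernel r) \<le> kernel_bound r" for r
  proof (cases "r \<in> {0<..T}")
    case True
    then have le: "norm (SF r) * norm (SH r) \<le> a r * C"
      using SF_le S_le[of r] by (intro mult_mono) (auto simp: SF_def SH_def intro: order_trans[OF norm_ge_zero])
    show ?thesis
    proof (rule norm_blinfun_bound)
      have "0 \<le> a r * C" by (rule order_trans[OF _ le]) simp
      then show "0 \<le> kernel_bound r" using True by (simp add: kernel_bound_def mult_ac)
      fix X
      have "norm (kernel r X) \<le> norm (SF r) * norm (SH r) * norm X + norm (SH r) * norm (SF r) * norm X"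
        unfolding kernel_apply by (intro norm_triangle_mono norm_sandwich_le)
      also have "\<dots> = 2 * (norm (SF r) * norm (SH r)) * norm X" by (simp add: mult_ac)
      also have "\<dots> \<le> 2 * (a r * C) * norm X" using le by (intro mult_right_mono) simp_all
      finally show "norm (kernel r X) \<le> kernel_bound r * norm X"
        using True by (simp add: kernel_bound_def mult_ac)
    qed
  next
    case False
    then have "SF r = 0" "SH r = 0" by (auto simp: SF_def SH_def)
    then have "kernel r = 0"
      by (intro blinfun_eqI trace_class_op_eqI)
        (simp add: kernel_apply op_of_simps op_of_sandwich blinfun.add_left)
    with False show ?thesis by (simp add: kernel_bound_def)
  qed
  have "set_integrable lebesgue {0<..T} a" by (rule set_integrable_subset[OF a_int]) auto
  then show "integrable lebesgue kernel_bound"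
    using integrable_mult_right[of "2 * C" lebesgue "\<lambda>r. indicator {0<..T} r * a r"]
    unfolding set_integrable_def kernel_bound_def by (simp add: mult_ac)
qed (simp add: kernel_bound_def)

abbreviation noise :: "real \<Rightarrow> 'h trace_class_op" where
  "noise \<equiv> noise_term Q S B"

definition inhom :: "real \<Rightarrow> 'h trace_class_op" where
  "inhom t = sandwich (on_H \<iota> S\<^sub>0 S t) (on_H \<iota> S\<^sub>0 S t) Q\<^sub>\<xi> + (LINT r:{0<..<t}|lebesgue. noise r)"

lemma continuous_noise: "continuous_on {0<..T} noise"
  unfolding continuous_on_def
proof (rule ballI, rule LIM_zero_cancel)
  fix t assume t: "t \<in> {0<..T}"
  let ?d = "\<lambda>r. hs_norm Q (\<lambda>u. S r (B u) - S t (B u))"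
  have "((\<lambda>r. (?d r)\<^sup>2 + 2 * ?d r * hs_norm Q (\<lambda>u. S t (B u))) \<longlongrightarrow>
      0\<^sup>2 + 2 * 0 * hs_norm Q (\<lambda>u. S t (B u))) (at t within {0<..T})"
    by (intro tendsto_intros SB_cont[OF t])
  then have "((\<lambda>r. (?d r)\<^sup>2 + 2 * ?d r * hs_norm Q (\<lambda>u. S t (B u))) \<longlongrightarrow> 0) (at t within {0<..T})"
    by simp
  then show "((\<lambda>r. noise r - noise t) \<longlongrightarrow> 0) (at t within {0<..T})"
    by (rule Lim_null_comparison[OF always_eventually[OF allI[OF norm_noise_term_diff_le[OF B]]]])
qed

definition noise_ext :: "real \<Rightarrow> 'h trace_class_op" where
  "noise_ext r = (if r \<in> {0<..T} then noise r else 0)"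

definition noise_bound :: "real \<Rightarrow> real" where
  "noise_bound r = indicator {0<..T} r * (b r)\<^sup>2"

lemma noise_ext_measurable: "noise_ext \<in> borel_measurable lebesgue"
  unfolding noise_ext_def[abs_def] by (rule measurable_zero_extension[OF continuous_noise])

lemma noise_bound_integrable: "integrable lebesgue noise_bound"
proof -
  have "set_integrable lebesgue {0<..T} (\<lambda>r. (b r)\<^sup>2)"
    by (rule set_integrable_subset[OF b_int]) auto
  then show ?thesis by (simp add: set_integrable_def noise_bound_def[abs_def])
qed

lemma norm_noise_ext_le: "norm (noise_ext r) \<le> noise_bound r"
proof (cases "r \<in> {0<..T}")
  case True
  have "norm (noise r) \<le> (hs_norm Q (\<lambda>u. S r (B u)))\<^sup>2" by (rule norm_noise_term_le[OF B])
  also have "\<dots> \<le> (b r)\<^sup>2" by (rule power_mono[OF SB_le[OF True] hs_norm_nonneg])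
  finally show ?thesis using True by (simp add: noise_ext_def noise_bound_def)
qed (simp add: noise_ext_def noise_bound_def del: greaterThanAtMost_iff)

lemma set_integrable_noise:
  assumes "t \<in> {0..T}"
  shows "set_integrable lebesgue {0<..<t} noise"
proof -
  have "integrable lebesgue noise_ext"
    by (rule Bochner_Integration.integrable_bound[OF noise_bound_integrable noise_ext_measurable])
      (intro AE_I2 order_trans[OF norm_noise_ext_le], simp)
  then have "set_integrable lebesgue {0<..<t} noise_ext"
    unfolding set_integrable_def by (intro integrable_mult_indicator) simp_all
  then show ?thesis
    by (rule set_integrable_cong[THEN iffD1, rotated 3])
      (use assms in \<open>auto simp: noise_ext_def\<close>)
qed

lemma continuous_inhom: "continuous_on {0..T} inhom"
  unfolding inhom_def
proof (rule continuous_on_add)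
  show "continuous_on {0..T} (\<lambda>t. sandwich (on_H \<iota> S\<^sub>0 S t) (on_H \<iota> S\<^sub>0 S t) Q\<^sub>\<xi>)"
    by (rule continuous_on_sandwich[OF S_cont S_le S_cont S_le])
  have "continuous_on {0..T} (\<lambda>t. LINT r:{0<..<t}|lebesgue. noise_ext r)"
    by (rule continuous_on_subset[OF continuous_truncated_integral[of "\<lambda>_. noise_ext"
            noise_bound]])
      (auto intro: noise_ext_measurable norm_noise_ext_le noise_bound_integrable)
  then show "continuous_on {0..T} (\<lambda>t. LINT r:{0<..<t}|lebesgue. noise r)"
    by (rule continuous_on_cong[THEN iffD1, OF refl, rotated])
      (intro set_lebesgue_integral_cong, auto simp: noise_ext_def)
qed

text \<open>Reflection of the integration variable turns both integrals into integrals in \<open>r = t - s\<close>; their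
  existence is automatic for continuous \<open>K\<close>.\<close>

lemma lyapunov_solution_iff:
  "lyapunov_solution T \<iota> Q S\<^sub>0 S F B Q\<^sub>\<xi> K \<longleftrightarrow>
    continuous_on {0..T} K \<and> (\<forall>t\<in>{0..T}. K t = inhom t + conv K t)"
proof -
  have noise: "set_integrable lebesgue {0<..<t} (\<lambda>s. noise (t - s))"
    "(LINT s:{0<..<t}|lebesgue. noise (t - s)) = (LINT r:{0<..<t}|lebesgue. noise r)"
    if "t \<in> {0..T}" for t
    using set_integrable_noise[OF that] by (simp_all add: set_integrable_reflect set_integral_reflect)
  have drift: "set_integrable lebesgue {0<..<t} (\<lambda>s. drift_term \<iota> S\<^sub>0 S F (t - s) (K s))"
    "(LINT s:{0<..<t}|lebesgue. drift_term \<iota> S\<^sub>0 S F (t - s) (K s)) = conv K t"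
    if t: "t \<in> {0..T}" and K: "continuous_on {0..T} K" for t
  proof -
    let ?h = "\<lambda>r. kernel r (K (t - r))"
    have eq: "drift_term \<iota> S\<^sub>0 S F (t - s) (K s) = ?h (t - s)" if "s \<in> {0<..<t}" for s
      using that t kernel_eq_drift_term[of "t - s" "K s"] by simp
    have "set_integrable lebesgue {0<..<t} (\<lambda>s. ?h (t - s))"
      using set_integrable_conv[OF T K t] by (simp only: set_integrable_reflect[where h = ?h])
    then show "set_integrable lebesgue {0<..<t} (\<lambda>s. drift_term \<iota> S\<^sub>0 S F (t - s) (K s))"
      by (rule set_integrable_cong[THEN iffD2, rotated 3]) (use eq in auto)
    have "(LINT s:{0<..<t}|lebesgue. drift_term \<iota> S\<^sub>0 S F (t - s) (K s))
        = (LINT s:{0<..<t}|lebesgue. ?h (t - s))"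
      by (rule set_lebesgue_integral_cong) (use eq in auto)
    then show "(LINT s:{0<..<t}|lebesgue. drift_term \<iota> S\<^sub>0 S F (t - s) (K s)) = conv K t"
      by (simp only: set_integral_reflect[where h = ?h] conv_def)
  qed
  show ?thesis
    unfolding lyapunov_solution_def inhom_def sandwich_def
    by (intro conj_cong refl ball_cong) (simp add: noise drift add_ac)
qed

text \<open>The initial term is \<open>S(t) Q\<^sub>\<xi> S(t)\<^sup>*\<close> with \<open>Q\<^sub>\<xi>\<close> symmetric, and the noise terms have the form \<open>G G\<^sup>*\<close>.\<close>

lemma tc_adj_inhom:
  assumes "t \<in> {0..T}"
  shows "tc_adj (inhom t) = inhom t"
proof -
  have "tc_adj Q\<^sub>\<xi> = Q\<^sub>\<xi>" by (simp add: tc_adj_eq_iff Q\<^sub>\<xi>)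
  then show ?thesis
    unfolding inhom_def
    by (simp add: linear_add[OF bounded_linear.linear[OF bounded_linear_tc_adj]] tc_adj_sandwich
        set_integral_bounded_linear[OF bounded_linear_tc_adj set_integrable_noise[OF assms]]
        tc_adj_noise_term[OF B])
qed

lemma tc_adj_conv:
  assumes "continuous_on {0..T} K" "t \<in> {0..T}"
  shows "tc_adj (conv K t) = conv (\<lambda>s. tc_adj (K s)) t"
  unfolding conv_def
  by (simp add: set_integral_bounded_linear[OF bounded_linear_tc_adj set_integrable_conv[OF T assms]]
      tc_adj_kernel)

text \<open>The adjoint of the solution solves the same equation, so uniqueness makes it symmetric.\<close>

lemma unique_symmetric_solution:
  "\<exists>K. lyapunov_solution T \<iota> Q S\<^sub>0 S F B Q\<^sub>\<xi> K \<and>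
     (\<forall>K'. lyapunov_solution T \<iota> Q S\<^sub>0 S F B Q\<^sub>\<xi> K' \<longrightarrow> (\<forall>t\<in>{0..T}. K' t = K t)) \<and>
     (\<forall>t\<in>{0..T}. op_of (K t) \<in> sym_ops)"
proof -
  obtain K where K: "continuous_on {0..T} K" "\<And>t. t \<in> {0..T} \<Longrightarrow> K t = inhom t + conv K t"
    using solution_exists[OF T continuous_inhom] by blast
  have unique: "K' t = K t" if "continuous_on {0..T} K'"
      "\<And>t. t \<in> {0..T} \<Longrightarrow> K' t = inhom t + conv K' t" "t \<in> {0..T}" for K' t
    by (rule solution_unique[OF T that(1,2) K that(3)])
  have "op_of (K t) \<in> sym_ops" if t: "t \<in> {0..T}" for t
    unfolding tc_adj_eq_iff[symmetric]
  proof (rule unique[OF _ _ t])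
    show "continuous_on {0..T} (\<lambda>t. tc_adj (K t))"
      by (rule bounded_linear.continuous_on[OF bounded_linear_tc_adj K(1)])
    show "tc_adj (K t) = inhom t + conv (\<lambda>s. tc_adj (K s)) t" if t: "t \<in> {0..T}" for t
      using arg_cong[OF K(2)[OF t], of tc_adj]
      by (simp add: linear_add[OF bounded_linear.linear[OF bounded_linear_tc_adj]] tc_adj_inhom[OF t]
          tc_adj_conv[OF K(1) t])
  qed
  then show ?thesis
    unfolding lyapunov_solution_iff using K unique by blast
qed

end

theorem proposition2p2:
  fixes \<iota> :: "'h::{real_inner,banach,second_countable_topology} \<Rightarrow>\<^sub>L
              'k::{real_inner,banach,second_countable_topology}"
    and Q :: "'u::{real_inner,banach,second_countable_topology} \<Rightarrow>\<^sub>L 'u"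
    and S\<^sub>0 :: "'h \<Rightarrow>\<^sub>L 'h"
    and S :: "real \<Rightarrow> 'k \<Rightarrow>\<^sub>L 'h"
    and F :: "'h \<Rightarrow>\<^sub>L 'k"
    and B :: "'u \<Rightarrow> 'k"
    and Q\<^sub>\<xi> :: "'h trace_class_op"
    and a b :: "real \<Rightarrow> real"
    and C T :: real
  assumes "0 \<le> T"
    and "inj (blinfun_apply \<iota>)" and "closure (range (blinfun_apply \<iota>)) = UNIV"
    and "Q \<in> psd_ops"
    and "hilbert_schmidt Q B"
    and "op_of Q\<^sub>\<xi> \<in> psd_ops"
    and "\<And>v. continuous_on {0..T} (\<lambda>t. blinfun_apply (on_H \<iota> S\<^sub>0 S t) v)"
    and "\<And>v. continuous_on {0<..T} (\<lambda>t. blinfun_apply (S t) (blinfun_apply F v))"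
    and "\<And>t. t \<in> {0<..T} \<Longrightarrow>
           ((\<lambda>r. hs_norm Q (\<lambda>u. blinfun_apply (S r) (B u) - blinfun_apply (S t) (B u)))
             \<longlongrightarrow> 0) (at t within {0<..T})"
    and "set_integrable lebesgue {0..T} a"
    and "set_borel_measurable lebesgue {0..T} b"
    and "set_integrable lebesgue {0..T} (\<lambda>t. (b t)\<^sup>2)"
    and "\<And>t. t \<in> {0..T} \<Longrightarrow> norm (on_H \<iota> S\<^sub>0 S t) \<le> C"
    and "\<And>t. t \<in> {0<..T} \<Longrightarrow> norm (S t o\<^sub>L F) \<le> a t"
    and "\<And>t. t \<in> {0<..T} \<Longrightarrow> hs_norm Q (\<lambda>u. blinfun_apply (S t) (B u)) \<le> b t"
  shows "\<exists>K. lyapunov_solution T \<iota> Q S\<^sub>0 S F B Q\<^sub>\<xi> K \<and>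
           (\<forall>K'. lyapunov_solution T \<iota> Q S\<^sub>0 S F B Q\<^sub>\<xi> K' \<longrightarrow> (\<forall>t\<in>{0..T}. K' t = K t)) \<and>
           (\<forall>t\<in>{0..T}. op_of (K t) \<in> sym_ops)"
proof -
  have "op_of Q\<^sub>\<xi> \<in> sym_ops" using assms(6) by (simp add: psd_ops_def)
  then interpret lyapunov_equation \<iota> Q S\<^sub>0 S F B Q\<^sub>\<xi> a b C T
    by unfold_locales (use assms in auto)
  show ?thesis by (rule unique_symmetric_solution)
qed

end
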